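(* Let $\kappa$ be a strongly inaccessible cardinal and let $\mathcal{F}$ be a $\kappa$-complete normal (nonprincipal) filter on $\kappa$. Then the product $\mathbb{MI}_\kappa^{\mathcal{F}}\times\mathbb{MI}_\kappa^{\mathcal{F}}$ adds a $\kappa$-Cohen function.
   Context: For a tree $T\subseteq\kappa^{<\kappa}$, $u\in T$ $\mathcal{F}$-splits if $\mathrm{succ}_T(u)=\{\beta<\kappa:u^\frown\beta\in T\}\in\mathcal{F}$. $\mathbb{MI}_\kappa^{\mathcal{F}}$ has as conditions the trees $T\subseteq\kappa^{<\kappa}$ of strictly increasing sequences such that (1) every $u\in T$ has an extension in $T$ that $\mathcal{F}$-splits, and if $u$ does not $\mathcal{F}$-split then $|\mathrm{succ}_T(u)|=1$; (2) if $\alpha<\kappa$ is a limit, $u\in\kappa^\alpha$ and $u\restriction\beta\in T$ for all $\beta<\alpha$, then $u\in T$; (3) if $\alpha<\kappa$ is a limit, $u\in\kappa^\alpha$ and $u\restriction\beta$ $\mathcal{F}$-splits for arbitrarily large $\beta<\alpha$, then $u$ $\mathcal{F}$-splits; ordered by inclusion. The product is ordered coordinatewise. A $\kappa$-Cohen function over the ground model $V$ is a $c\in2^\kappa$ that is $\mathrm{Fn}(\kappa,2,\kappa)$-generic over $V$, where $\mathrm{Fn}(\kappa,2,\kappa)$ is the poset of partial functions $\kappa\to2$ with domain of size $<\kappa$, ordered by reverse inclusion. *)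

theory Defs
  imports Main
begin

unbundle cardinal_syntax

text \<open>
  The cardinal \<open>\<kappa>\<close> is a type \<open>'k\<close> of class \<open>wellorder\<close> whose order is required to be a
  cardinal order. The elements of \<open>'k\<close> are the ordinals below \<open>\<kappa>\<close>, and \<open>{..<\<alpha>}\<close> is the
  ordinal \<open>\<alpha>\<close>. The ground model is the HOL universe.
\<close>

definition strongly_inaccessible :: "'a rel \<Rightarrow> bool" where
  "strongly_inaccessible r \<longleftrightarrow>
     Card_order r \<and> natLeq <o r \<and> regularCard r \<and>
     (\<forall>A \<subseteq> Field r. |A| <o r \<longrightarrow> |Pow A| <o r)"

definition limit_ordinal :: "'k::wellorder \<Rightarrow> bool" where
  "limit_ordinal \<alpha> \<longleftrightarrow> (\<exists>\<beta>. \<beta> < \<alpha>) \<and> (\<forall>\<beta><\<alpha>. \<exists>\<gamma>. \<beta> < \<gamma> \<and> \<gamma> < \<alpha>)"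

section \<open>Filters on \<open>\<kappa>\<close>\<close>

definition kappa_complete :: "'k filter \<Rightarrow> bool" where
  "kappa_complete F \<longleftrightarrow>
     (\<forall>\<X>. |\<X>| <o |UNIV :: 'k set| \<and> (\<forall>X\<in>\<X>. \<forall>\<^sub>F \<beta> in F. \<beta> \<in> X) \<longrightarrow> (\<forall>\<^sub>F \<beta> in F. \<beta> \<in> \<Inter>\<X>))"

text \<open>Closure under diagonal intersections \<open>{\<beta>. \<forall>\<alpha><\<beta>. \<beta> \<in> X \<alpha>}\<close>.\<close>

definition normal_filter :: "'k::wellorder filter \<Rightarrow> bool" where
  "normal_filter F \<longleftrightarrow>
     (\<forall>X :: 'k \<Rightarrow> 'k set. (\<forall>\<alpha>. \<forall>\<^sub>F \<beta> in F. \<beta> \<in> X \<alpha>) \<longrightarrow> (\<forall>\<^sub>F \<beta> in F. \<forall>\<alpha><\<beta>. \<beta> \<in> X \<alpha>))"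

definition nonprincipal :: "'k filter \<Rightarrow> bool" where
  "nonprincipal F \<longleftrightarrow> (\<forall>A. F \<noteq> principal A)"

section \<open>The forcing \<open>MI\<close>\<close>

text \<open>
  A sequence of length \<open>\<alpha> < \<kappa>\<close> is a partial map with domain \<open>{..<\<alpha>}\<close>; end-extension of
  sequences is \<open>\<subseteq>\<^sub>m\<close> and the restriction of \<open>u\<close> to \<open>\<beta>\<close> is \<open>u |` {..<\<beta>}\<close>.
\<close>

definition seqs :: "'k::wellorder \<Rightarrow> ('k \<rightharpoonup> 'k) set" where
  "seqs \<alpha> = {u. dom u = {..<\<alpha>}}"

definition lh :: "('k::wellorder \<rightharpoonup> 'k) \<Rightarrow> 'k" where
  "lh u = (LEAST \<alpha>. \<alpha> \<notin> dom u)"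

definition snoc :: "('k::wellorder \<rightharpoonup> 'k) \<Rightarrow> 'k \<Rightarrow> ('k \<rightharpoonup> 'k)" where
  "snoc u \<beta> = u(lh u \<mapsto> \<beta>)"

definition is_tree :: "('k::wellorder \<rightharpoonup> 'k) set \<Rightarrow> bool" where
  "is_tree T \<longleftrightarrow> T \<noteq> {} \<and> T \<subseteq> (\<Union>\<alpha>. seqs \<alpha>) \<and> (\<forall>u\<in>T. \<forall>\<beta>. u |` {..<\<beta>} \<in> T)"

definition succs :: "('k::wellorder \<rightharpoonup> 'k) set \<Rightarrow> ('k \<rightharpoonup> 'k) \<Rightarrow> 'k set" where
  "succs T u = {\<beta>. snoc u \<beta> \<in> T}"

definition splits :: "'k::wellorder filter \<Rightarrow> ('k \<rightharpoonup> 'k) set \<Rightarrow> ('k \<rightharpoonup> 'k) \<Rightarrow> bool" where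
  "splits F T u \<longleftrightarrow> u \<in> T \<and> (\<forall>\<^sub>F \<beta> in F. \<beta> \<in> succs T u)"

definition MI :: "'k::wellorder filter \<Rightarrow> ('k \<rightharpoonup> 'k) set set" where
  "MI F = {T. is_tree T \<and>
     (\<forall>u\<in>T. strict_mono_on (dom u) (\<lambda>\<xi>. the (u \<xi>))) \<and>
     (\<forall>u\<in>T. (\<exists>v\<in>T. u \<subseteq>\<^sub>m v \<and> splits F T v) \<and> (\<not> splits F T u \<longrightarrow> card (succs T u) = 1)) \<and>
     (\<forall>\<alpha> u. limit_ordinal \<alpha> \<and> u \<in> seqs \<alpha> \<and> (\<forall>\<beta><\<alpha>. u |` {..<\<beta>} \<in> T) \<longrightarrow> u \<in> T) \<and>
     (\<forall>\<alpha> u. limit_ordinal \<alpha> \<and> u \<in> seqs \<alpha> \<and>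
        (\<forall>\<gamma><\<alpha>. \<exists>\<beta>. \<gamma> \<le> \<beta> \<and> \<beta> < \<alpha> \<and> splits F T (u |` {..<\<beta>})) \<longrightarrow> splits F T u)}"

definition prod_le :: "('p \<Rightarrow> 'p \<Rightarrow> bool) \<Rightarrow> ('q \<Rightarrow> 'q \<Rightarrow> bool) \<Rightarrow> 'p \<times> 'q \<Rightarrow> 'p \<times> 'q \<Rightarrow> bool" where
  "prod_le le1 le2 = (\<lambda>(p, q) (p', q'). le1 p p' \<and> le2 q q')"

section \<open>The forcing \<open>Fn(\<kappa>, 2, \<kappa>)\<close>\<close>

definition Fn :: "'k set \<Rightarrow> ('k \<rightharpoonup> bool) set" where
  "Fn K = {s. dom s \<subseteq> K \<and> |dom s| <o |K|}"

definition Fn_le :: "('k \<rightharpoonup> bool) \<Rightarrow> ('k \<rightharpoonup> bool) \<Rightarrow> bool" where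
  "Fn_le s t \<longleftrightarrow> t \<subseteq>\<^sub>m s"

definition dense_in :: "'q set \<Rightarrow> ('q \<Rightarrow> 'q \<Rightarrow> bool) \<Rightarrow> 'q set \<Rightarrow> bool" where
  "dense_in Q leQ D \<longleftrightarrow> D \<subseteq> Q \<and> (\<forall>q\<in>Q. \<exists>d\<in>D. leQ d q)"

section \<open>The forcing relation\<close>

text \<open>
  A sentence of the forcing language of \<open>P\<close> is represented by the predicate "\<open>p\<close> forces it",
  and the connectives are the recursion clauses of the forcing relation. Quantifiers range over
  ground model sets. A name for a subset of a ground model set \<open>X\<close> is a set of pairs \<open>(x, s)\<close>
  with \<open>x \<in> X\<close> and \<open>s \<in> P\<close>, where \<open>x\<close> stands for its check name; every subset of \<open>X\<close> in the
  generic extension has such a name.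
\<close>

type_synonym 'p sentence = "'p \<Rightarrow> bool"

locale forcing =
  fixes P :: "'p set" and le :: "'p \<Rightarrow> 'p \<Rightarrow> bool"  (infix "\<preceq>" 50)
begin

definition dense_below :: "'p \<Rightarrow> ('p \<Rightarrow> bool) \<Rightarrow> bool" where
  "dense_below p D \<longleftrightarrow> (\<forall>q\<in>P. q \<preceq> p \<longrightarrow> (\<exists>r\<in>P. r \<preceq> q \<and> D r))"

definition Mem :: "'x \<Rightarrow> ('x \<times> 'p) set \<Rightarrow> 'p sentence" where
  "Mem x \<tau> = (\<lambda>p. dense_below p (\<lambda>r. \<exists>s. (x, s) \<in> \<tau> \<and> r \<preceq> s))"

definition Conj :: "'p sentence \<Rightarrow> 'p sentence \<Rightarrow> 'p sentence" where
  "Conj \<phi> \<psi> = (\<lambda>p. \<phi> p \<and> \<psi> p)"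

definition Neg :: "'p sentence \<Rightarrow> 'p sentence" where
  "Neg \<phi> = (\<lambda>p. \<not> (\<exists>q\<in>P. q \<preceq> p \<and> \<phi> q))"

definition Imp :: "'p sentence \<Rightarrow> 'p sentence \<Rightarrow> 'p sentence" where
  "Imp \<phi> \<psi> = Neg (Conj \<phi> (Neg \<psi>))"

definition Forall :: "'x set \<Rightarrow> ('x \<Rightarrow> 'p sentence) \<Rightarrow> 'p sentence" where
  "Forall X \<phi> = (\<lambda>p. \<forall>x\<in>X. \<phi> x p)"

definition Exists :: "'x set \<Rightarrow> ('x \<Rightarrow> 'p sentence) \<Rightarrow> 'p sentence" where
  "Exists X \<phi> = (\<lambda>p. dense_below p (\<lambda>r. \<exists>x\<in>X. \<phi> x r))"

definition forced :: "'p sentence \<Rightarrow> bool" where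
  "forced \<phi> \<longleftrightarrow> (\<forall>p\<in>P. \<phi> p)"

text \<open>\<open>G q\<close> is the sentence expressing \<open>q \<in> G\<close>.\<close>

definition Generic_filter ::
  "'q set \<Rightarrow> ('q \<Rightarrow> 'q \<Rightarrow> bool) \<Rightarrow> ('q \<Rightarrow> 'p sentence) \<Rightarrow> 'p sentence" where
  "Generic_filter Q leQ G =
     Conj (Exists Q G)
    (Conj (Forall Q (\<lambda>s. Forall {t\<in>Q. leQ s t} (\<lambda>t. Imp (G s) (G t))))
    (Conj (Forall Q (\<lambda>s. Forall Q (\<lambda>t. Imp (Conj (G s) (G t)) (Exists {r\<in>Q. leQ r s \<and> leQ r t} G))))
          (Forall {D. dense_in Q leQ D} (\<lambda>D. Exists D G))))"

definition Function_to_2 :: "'k set \<Rightarrow> (('k \<times> bool) \<times> 'p) set \<Rightarrow> 'p sentence" where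
  "Function_to_2 K \<tau> =
     Forall K (\<lambda>\<alpha>. Conj (Exists UNIV (\<lambda>i. Mem (\<alpha>, i) \<tau>))
                      (Neg (Conj (Mem (\<alpha>, False) \<tau>) (Mem (\<alpha>, True) \<tau>))))"

definition Below :: "('k \<rightharpoonup> bool) \<Rightarrow> (('k \<times> bool) \<times> 'p) set \<Rightarrow> 'p sentence" where
  "Below s \<tau> = Forall (Map.graph s) (\<lambda>x. Mem x \<tau>)"

text \<open>A function \<open>c\<close> is generic for \<open>Fn\<close> iff \<open>{s \<in> Fn K. s \<subseteq> c}\<close> is a generic filter.\<close>

definition Cohen_function :: "'k set \<Rightarrow> (('k \<times> bool) \<times> 'p) set \<Rightarrow> 'p sentence" where
  "Cohen_function K \<tau> =
     Conj (Function_to_2 K \<tau>) (Generic_filter (Fn K) Fn_le (\<lambda>s. Below s \<tau>))"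

definition adds_Cohen_function :: "'k set \<Rightarrow> bool" where
  "adds_Cohen_function K \<longleftrightarrow> (\<exists>\<tau> \<subseteq> (K \<times> UNIV) \<times> P. forced (Cohen_function K \<tau>))"

end

end

theory Submission
  imports Defs
begin

text \<open>
  Let \<open>f\<close> and \<open>g\<close> be the two generic increasing functions. At a common limit point \<open>\<eta>\<close> of their
  ranges, compare the next value of \<open>f\<close> with the next value of \<open>g\<close>; the bits obtained in this way,
  enumerated along the common limit points, form a Cohen function. To write a prescribed bit, extend
  the two stems alternately to longer splitting nodes, each time with new values above everything
  used before. The two sequences are then blockwise interlaced, so no common limit point arises
  before stage \<open>\<omega>\<close>, where the two unions have the same supremum and still split; the bit at the
  old supremum is determined by which stem moves first. Iterating through limits of length less
  than \<open>\<kappa>\<close> writes any prescribed condition of \<open>Fn\<close>. If the filter does not contain all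
  final segments of \<open>\<kappa>\<close>, then \<open>MI\<close> is empty.
\<close>

section \<open>From settled bits to a forced Cohen function\<close>

lemma finite_card_less: "finite A \<Longrightarrow> infinite B \<Longrightarrow> |A| <o |B|"
  by (rule finite_ordLess_infinite[OF card_of_Well_order card_of_Well_order])
    (simp_all add: Field_card_of)

lemma Fn_upd:
  assumes "infinite K" "s \<in> Fn K" "i \<in> K"
  shows "s(i \<mapsto> b) \<in> Fn K"
  using assms card_of_Un_ordLess_infinite[of K "{i}" "dom s"] finite_card_less[of "{i}" K]
  by (simp add: Fn_def)

lemma Fn_map_add:
  assumes "infinite K" "s \<in> Fn K" "t \<in> Fn K"
  shows "s ++ t \<in> Fn K"
  using assms card_of_Un_ordLess_infinite[of K "dom t" "dom s"] by (auto simp: Fn_def)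

text \<open>Read \<open>C p i b\<close> as: \<open>p\<close> settles bit \<open>i\<close> to be
  \<open>b\<close>. Assumption \<open>ext\<close> says that whatever \<open>p\<close> restricts is
  captured by a small \<open>c\<close>, since every condition of \<open>Fn\<close> containing
  \<open>c\<close> can be realised below \<open>p\<close>. Genericity follows by applying the
  density of \<open>D\<close> to this \<open>c\<close>: the element found contains \<open>c\<close>
  and is therefore realisable.\<close>

lemma (in forcing) adds_Cohen_functionI:
  fixes C :: "'p \<Rightarrow> 'k \<Rightarrow> bool \<Rightarrow> bool"
  assumes K: "infinite K"
    and refl: "\<And>p. p \<preceq> p"
    and trans: "\<And>p q r. p \<preceq> q \<Longrightarrow> q \<preceq> r \<Longrightarrow> p \<preceq> r"
    and mono: "\<And>p q i b. p \<in> P \<Longrightarrow> q \<in> P \<Longrightarrow> p \<preceq> q \<Longrightarrow> C q i b \<Longrightarrow> C p i b"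
    and inj: "\<And>p i b b'. p \<in> P \<Longrightarrow> C p i b \<Longrightarrow> C p i b' \<Longrightarrow> b = b'"
    and ext: "\<And>p. p \<in> P \<Longrightarrow> \<exists>c\<in>Fn K. \<forall>s\<in>Fn K. c \<subseteq>\<^sub>m s \<longrightarrow>
                (\<exists>r\<in>P. r \<preceq> p \<and> (\<forall>i b. s i = Some b \<longrightarrow> C r i b))"
  shows "adds_Cohen_function K"
proof -
  define \<tau> where "\<tau> = {((i, b), p). i \<in> K \<and> p \<in> P \<and> C p i b}"
  \<comment> \<open>The existential over \<open>s\<close> in \<open>Mem\<close> collapses:
    reflexivity gives one direction, monotonicity of \<open>C\<close> the other.\<close>
  have Mem_iff: "Mem (i, b) \<tau> p \<longleftrightarrow> dense_below p (\<lambda>r. C r i b)" if "i \<in> K" for i b p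
  proof -
    have "(\<exists>s. ((i, b), s) \<in> \<tau> \<and> r \<preceq> s) \<longleftrightarrow> C r i b" if "r \<in> P" for r
      using that \<open>i \<in> K\<close> refl mono unfolding \<tau>_def by blast
    then show ?thesis unfolding Mem_def dense_below_def by blast
  qed
  have Mem_mono: "Mem x \<tau> q" if "Mem x \<tau> p" "q \<preceq> p" for x p q
    using that trans unfolding Mem_def dense_below_def by blast
  have MemI: "Mem (i, b) \<tau> p" if "C p i b" "i \<in> K" "p \<in> P" for i b p
    unfolding Mem_iff[OF that(2)] dense_below_def using that by (auto intro: refl mono)
  have Mem_inj: "b = b'" if mem: "Mem (i, b) \<tau> p" "Mem (i, b') \<tau> p" and "p \<in> P" and i: "i \<in> K" for i b b' p
  proof -
    obtain r where r: "r \<in> P" "r \<preceq> p" "C r i b"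
      using mem(1) refl \<open>p \<in> P\<close> unfolding Mem_iff[OF i] dense_below_def by blast
    then obtain r' where "r' \<in> P" "r' \<preceq> r" "C r' i b'"
      using mem(2) unfolding Mem_iff[OF i] dense_below_def by blast
    with r show ?thesis using mono inj by metis
  qed
  have dom_K: "i \<in> K" if "s \<in> Fn K" "s i = Some b" for s :: "'k \<rightharpoonup> bool" and i b
    using that unfolding Fn_def by auto
  have fun2: "Function_to_2 K \<tau> p" if "p \<in> P" for p
    unfolding Function_to_2_def Forall_def Conj_def Exists_def Neg_def
  proof (intro ballI conjI)
    fix i assume i: "i \<in> K"
    show "dense_below p (\<lambda>r. \<exists>x\<in>UNIV. Mem (i, x) \<tau> r)"
      unfolding dense_below_def
    proof (intro ballI impI)
      fix q assume "q \<in> P" "q \<preceq> p"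
      obtain c where c: "c \<in> Fn K" "\<forall>s\<in>Fn K. c \<subseteq>\<^sub>m s \<longrightarrow>
          (\<exists>r\<in>P. r \<preceq> q \<and> (\<forall>i b. s i = Some b \<longrightarrow> C r i b))"
        using ext[OF \<open>q \<in> P\<close>] by blast
      \<comment> \<open>If \<open>c\<close> leaves \<open>i\<close> open, either value can be
        realised; \<open>True\<close> is an arbitrary choice.\<close>
      define s where "s = (if i \<in> dom c then c else c(i \<mapsto> True))"
      have "s \<in> Fn K" "c \<subseteq>\<^sub>m s"
        using c(1) Fn_upd[OF K c(1) i] by (auto simp: s_def map_le_def)
      then obtain r where r: "r \<in> P" "r \<preceq> q" "\<forall>i b. s i = Some b \<longrightarrow> C r i b"
        using c(2) by blast
      have "i \<in> dom s" by (simp add: s_def)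
      then obtain b where "s i = Some b" by blast
      then show "\<exists>r\<in>P. r \<preceq> q \<and> (\<exists>x\<in>UNIV. Mem (i, x) \<tau> r)"
        using r MemI i by blast
    qed
    show "\<not> (\<exists>q\<in>P. q \<preceq> p \<and> Mem (i, False) \<tau> q \<and> Mem (i, True) \<tau> q)"
      using Mem_inj i by blast
  qed
  have gen1: "Exists (Fn K) (\<lambda>s. Below s \<tau>) p" for p
  proof -
    have "Map.empty \<in> Fn K"
      using K by (simp add: Fn_def finite_card_less)
    moreover have "Below Map.empty \<tau> r" for r by (simp add: Below_def Forall_def)
    ultimately show ?thesis unfolding Exists_def dense_below_def using refl by blast
  qed
  have gen2: "Imp (Below s \<tau>) (Below t \<tau>) p" if "Fn_le s t" for s t p
  proof -
    have "Map.graph t \<subseteq> Map.graph s"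
      using that unfolding Fn_le_def map_le_def Map.graph_def by (auto dest!: bspec intro: domI)
    then have "Below t \<tau> q" if "Below s \<tau> q" for q
      using that unfolding Below_def Forall_def by blast
    then show ?thesis unfolding Imp_def Neg_def Conj_def using refl by blast
  qed
  have gen3: "Imp (Conj (Below s \<tau>) (Below t \<tau>)) (Exists {r\<in>Fn K. Fn_le r s \<and> Fn_le r t} (\<lambda>s. Below s \<tau>)) p"
    if s: "s \<in> Fn K" and t: "t \<in> Fn K" for s t p
  proof -
    have "Exists {r\<in>Fn K. Fn_le r s \<and> Fn_le r t} (\<lambda>s. Below s \<tau>) q"
      if q: "q \<in> P" "Below s \<tau> q" "Below t \<tau> q" for q
    proof -
      have st: "s ++ t \<in> Fn K" using Fn_map_add[OF K s t] .
      \<comment> \<open>\<open>q\<close> forces both graphs into \<tau>, and no condition forces two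
        values at one argument. So \<open>s\<close> and \<open>t\<close> agree where both are
        defined, and \<open>s ++ t\<close> extends each.\<close>
      have eq: "b = b'" if "s i = Some b" "t i = Some b'" for i b b'
      proof (rule Mem_inj)
        show "Mem (i, b) \<tau> q" "Mem (i, b') \<tau> q"
          using that q(2,3) unfolding Below_def Forall_def Map.graph_def by auto
      qed (use that q(1) dom_K[OF s] in auto)
      have "Fn_le (s ++ t) t" by (simp add: Fn_le_def)
      moreover have "Fn_le (s ++ t) s"
        unfolding Fn_le_def map_le_def using eq by (auto simp: map_add_def split: option.splits)
      moreover have "Below (s ++ t) \<tau> q'" if "q' \<preceq> q" for q'
        using q(2,3) Mem_mono[OF _ that] unfolding Below_def Forall_def Map.graph_def by auto
      ultimately show ?thesis using st refl unfolding Exists_def dense_below_def by blast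
    qed
    then show ?thesis unfolding Imp_def Neg_def Conj_def using refl by blast
  qed
  have gen4: "Exists D (\<lambda>s. Below s \<tau>) p" if "dense_in (Fn K) Fn_le D" for p D
    unfolding Exists_def dense_below_def
  proof (intro ballI impI)
    fix q assume "q \<in> P" "q \<preceq> p"
    obtain c where c: "c \<in> Fn K" "\<forall>s\<in>Fn K. c \<subseteq>\<^sub>m s \<longrightarrow>
        (\<exists>r\<in>P. r \<preceq> q \<and> (\<forall>i b. s i = Some b \<longrightarrow> C r i b))"
      using ext[OF \<open>q \<in> P\<close>] by blast
    then obtain d where d: "d \<in> D" "d \<in> Fn K" "c \<subseteq>\<^sub>m d"
      using \<open>dense_in (Fn K) Fn_le D\<close> unfolding dense_in_def Fn_le_def by blast
    then obtain r where r: "r \<in> P" "r \<preceq> q" "\<forall>i b. d i = Some b \<longrightarrow> C r i b"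
      using c(2) by blast
    then have "Below d \<tau> r"
      unfolding Below_def Forall_def Map.graph_def using MemI dom_K[OF d(2)] by auto
    with r d show "\<exists>r\<in>P. r \<preceq> q \<and> (\<exists>x\<in>D. Below x \<tau> r)" by blast
  qed
  have "forced (Cohen_function K \<tau>)"
    unfolding forced_def Cohen_function_def Generic_filter_def
    using fun2 gen1 gen2 gen3 gen4 by (simp add: Conj_def Forall_def)
  moreover have "\<tau> \<subseteq> (K \<times> UNIV) \<times> P" by (auto simp: \<tau>_def)
  ultimately show ?thesis unfolding adds_Cohen_function_def by blast
qed

section \<open>Common limit points of two sets of ordinals\<close>

text \<open>The first conjunct excludes the least element, for which the second holds vacuously. A
  limit point need not belong to the set.\<close>

definition lim_pts :: "'k::wellorder set \<Rightarrow> 'k set" where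
  "lim_pts A = {\<eta>. (\<exists>\<xi>. \<xi> < \<eta>) \<and> (\<forall>\<xi><\<eta>. \<exists>x\<in>A. \<xi> < x \<and> x < \<eta>)}"

text \<open>
  Common limit points, and those among them which are \<^emph>\<open>decided\<close>: both sets have already
  taken a value beyond the limit, so that end-extensions do not change the bit read off there.
\<close>

definition clp :: "'k::wellorder set \<Rightarrow> 'k set \<Rightarrow> 'k set" where
  "clp A B = lim_pts A \<inter> lim_pts B"

definition dclp :: "'k::wellorder set \<Rightarrow> 'k set \<Rightarrow> 'k set" where
  "dclp A B = {\<eta> \<in> clp A B. (\<exists>x\<in>A. \<eta> \<le> x) \<and> (\<exists>y\<in>B. \<eta> \<le> y)}"

text \<open>The bit read off at \<eta>. For a decided \<eta> it compares the least elements of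
  \<open>A\<close> and of \<open>B\<close> from \<eta> on; a tie reads as
  \<open>False\<close>.\<close>

definition leads :: "'k::wellorder set \<Rightarrow> 'k set \<Rightarrow> 'k \<Rightarrow> bool" where
  "leads A B \<eta> \<longleftrightarrow> (\<exists>x\<in>A. \<eta> \<le> x \<and> (\<forall>y\<in>B. \<eta> \<le> y \<longrightarrow> x < y))"

text \<open>The order type of \<open>L \<inter> {..<\<eta>}\<close>.\<close>

function rk :: "'k::wellorder set \<Rightarrow> 'k \<Rightarrow> 'k" where
  "rk L \<eta> = (LEAST i. \<forall>\<zeta>\<in>L \<inter> {..<\<eta>}. rk L \<zeta> < i)"
  by auto
termination
  by (relation "inv_image {(x, y). x < y} snd") (auto simp: wf)

declare rk.simps [simp del]

text \<open>Only decided points are enumerated. A common supremum that neither set has passed gets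
  no bit yet, so a bit once present never changes.\<close>

definition code :: "'k::wellorder set \<Rightarrow> 'k set \<Rightarrow> 'k \<rightharpoonup> bool" where
  "code A B i = (if i \<in> rk (dclp A B) ` dclp A B
     then Some (\<exists>\<eta>\<in>dclp A B. rk (dclp A B) \<eta> = i \<and> leads A B \<eta>) else None)"

definition end_ext :: "'k::wellorder set \<Rightarrow> 'k set \<Rightarrow> bool" where
  "end_ext A A' \<longleftrightarrow> A \<subseteq> A' \<and> (\<forall>x\<in>A. \<forall>y\<in>A' - A. x < y)"

text \<open>Mutual strict cofinality: neither set has a maximum, and if they are bounded they share
  a supremum, which is a common limit point still waiting for its bit.\<close>

definition interleaved :: "'k::wellorder set \<Rightarrow> 'k set \<Rightarrow> bool" where
  "interleaved A B \<longleftrightarrow> A \<noteq> {} \<and> (\<forall>x\<in>A. \<exists>y\<in>B. x < y) \<and> (\<forall>y\<in>B. \<exists>x\<in>A. y < x)"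

lemma rk_le: "rk L \<eta> \<le> \<eta>"
proof (induction \<eta> rule: less_induct)
  case (less \<eta>)
  then show ?case unfolding rk.simps[of L \<eta>] by (intro Least_le) force
qed

lemma rk_less: "\<zeta> \<in> L \<Longrightarrow> \<zeta> < \<eta> \<Longrightarrow> rk L \<zeta> < rk L \<eta>"
proof -
  assume \<zeta>: "\<zeta> \<in> L" "\<zeta> < \<eta>"
  have "\<forall>\<zeta>\<in>L \<inter> {..<\<eta>}. rk L \<zeta> < rk L \<eta>"
    unfolding rk.simps[of L \<eta>] by (rule LeastI[of _ \<eta>]) (use rk_le le_less_trans in blast)
  with \<zeta> show ?thesis by auto
qed

text \<open>Minimality of the rank yields an earlier point of rank at least \<open>i\<close>;
  induction on the point descends from there to rank exactly \<open>i\<close>. Hence codes have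
  initial segments as domains.\<close>

lemma rk_initial: "i < rk L \<eta> \<Longrightarrow> \<exists>\<zeta>\<in>L. \<zeta> < \<eta> \<and> rk L \<zeta> = i"
proof (induction \<eta> rule: less_induct)
  case (less \<eta>)
  have "\<not> (\<forall>\<zeta>\<in>L \<inter> {..<\<eta>}. rk L \<zeta> < i)"
    using not_less_Least less.prems unfolding rk.simps[of L \<eta>] by blast
  then obtain \<zeta> where "\<zeta> \<in> L" "\<zeta> < \<eta>" "i \<le> rk L \<zeta>" by force
  note \<zeta> = this
  show ?case
  proof (cases "i = rk L \<zeta>")
    case True
    with \<zeta> show ?thesis by blast
  next
    case False
    then have "i < rk L \<zeta>" using \<zeta>(3) by simp
    from less.IH[OF \<zeta>(2) this] \<zeta>(2) show ?thesis by (blast intro: less_trans)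
  qed
qed

lemma rk_cong: "L \<inter> {..<\<eta>} = L' \<inter> {..<\<eta>} \<Longrightarrow> rk L \<eta> = rk L' \<eta>"
proof (induction \<eta> rule: less_induct)
  case (less \<eta>)
  have "rk L \<zeta> = rk L' \<zeta>" if "\<zeta> < \<eta>" for \<zeta>
  proof (rule less.IH[OF that])
    have "{..<\<zeta>} = {..<\<eta>} \<inter> {..<\<zeta>}" using that by auto
    with less.prems show "L \<inter> {..<\<zeta>} = L' \<inter> {..<\<zeta>}" by (metis Int_assoc)
  qed
  then have "(\<forall>\<zeta>\<in>L \<inter> {..<\<eta>}. rk L \<zeta> < i) = (\<forall>\<zeta>\<in>L' \<inter> {..<\<eta>}. rk L' \<zeta> < i)" for i
    unfolding less.prems[symmetric] by simp
  then show ?case unfolding rk.simps[of L \<eta>] rk.simps[of L' \<eta>] by presburger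
qed

lemma lim_pts_mono: "A \<subseteq> A' \<Longrightarrow> lim_pts A \<subseteq> lim_pts A'"
  unfolding lim_pts_def by blast

text \<open>Whatever is added to \<open>A\<close> exceeds \<open>x\<close> and so lies beyond
  \<eta>, whereas being a limit point concerns only elements below \<eta>.\<close>

lemma lim_pts_end_ext:
  assumes "end_ext A A'" "x \<in> A" "\<eta> \<le> x"
  shows "\<eta> \<in> lim_pts A' \<longleftrightarrow> \<eta> \<in> lim_pts A"
proof -
  have "y \<in> A' \<and> y < \<eta> \<longleftrightarrow> y \<in> A \<and> y < \<eta>" for y
    using assms unfolding end_ext_def by (metis DiffI leD less_le_trans less_imp_le subsetD)
  then show ?thesis unfolding lim_pts_def by blast
qed

lemma clp_end_ext:
  assumes "end_ext A A'" "end_ext B B'" "x \<in> A" "\<eta> \<le> x" "y \<in> B" "\<eta> \<le> y"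
  shows "\<eta> \<in> clp A' B' \<longleftrightarrow> \<eta> \<in> clp A B"
  using assms lim_pts_end_ext[of A A' x] lim_pts_end_ext[of B B' y] unfolding clp_def by blast

text \<open>A decided point comes with values of both sets at or beyond it, so no added element can
  interfere at or below it.\<close>

lemma dclp_end_ext:
  assumes "end_ext A A'" "end_ext B B'" "\<eta> \<in> dclp A B" "\<zeta> \<le> \<eta>"
  shows "\<zeta> \<in> dclp A' B' \<longleftrightarrow> \<zeta> \<in> dclp A B"
proof -
  obtain x y where "x \<in> A" "\<zeta> \<le> x" "y \<in> B" "\<zeta> \<le> y"
    using assms(3,4) unfolding dclp_def by (auto dest: order_trans)
  then show ?thesis
    using clp_end_ext[OF assms(1,2)] assms(1,2) unfolding dclp_def end_ext_def by blast
qed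

lemma leads_end_ext:
  assumes "end_ext A A'" "end_ext B B'" "\<eta> \<in> dclp A B"
  shows "leads A' B' \<eta> \<longleftrightarrow> leads A B \<eta>"
proof -
  obtain x0 y0 where x0: "x0 \<in> A" "\<eta> \<le> x0" and y0: "y0 \<in> B" "\<eta> \<le> y0"
    using assms(3) unfolding dclp_def by auto
  show ?thesis
  proof
    assume "leads A' B' \<eta>"
    then obtain x where x: "x \<in> A'" "\<eta> \<le> x" "\<forall>y\<in>B'. \<eta> \<le> y \<longrightarrow> x < y"
      unfolding leads_def by blast
    show "leads A B \<eta>"
    proof (cases "x \<in> A")
      case True
      then show ?thesis using x assms(2) unfolding leads_def end_ext_def by blast
    next
      case False
      \<comment> \<open>An added witness can be traded for \<open>x0\<close>, which is smaller and
        still at or beyond \<eta>.\<close>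
      then have "x0 < x" using x(1) x0(1) assms(1) unfolding end_ext_def by blast
      then have "\<forall>y\<in>B. \<eta> \<le> y \<longrightarrow> x0 < y"
        using x(3) assms(2) unfolding end_ext_def by (meson order.strict_trans subsetD)
      then show ?thesis using x0 unfolding leads_def by blast
    qed
  next
    assume "leads A B \<eta>"
    then obtain x where x: "x \<in> A" "\<eta> \<le> x" "\<forall>y\<in>B. \<eta> \<le> y \<longrightarrow> x < y"
      unfolding leads_def by blast
    \<comment> \<open>The old element \<open>y0\<close> satisfies \<open>x < y0\<close>, and
      everything added to \<open>B\<close> exceeds \<open>y0\<close>.\<close>
    then have "x < y" if "y \<in> B'" "\<eta> \<le> y" for y
      using that y0 assms(2) unfolding end_ext_def by (meson DiffI order.strict_trans)
    then show "leads A' B' \<eta>" using x assms(1) unfolding leads_def end_ext_def by blast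
  qed
qed

lemma dom_code: "dom (code A B) = rk (dclp A B) ` dclp A B"
  by (auto simp: code_def split: if_splits)

lemma code_initial: "i \<in> dom (code A B) \<Longrightarrow> j < i \<Longrightarrow> j \<in> dom (code A B)"
  unfolding dom_code using rk_initial by blast

lemma rk_inj: "inj_on (rk L) L"
  by (rule inj_onI) (metis less_irrefl neqE rk_less)

lemma code_rk: "\<eta> \<in> dclp A B \<Longrightarrow> code A B (rk (dclp A B) \<eta>) = Some (leads A B \<eta>)"
  using inj_onD[OF rk_inj[of "dclp A B"]] unfolding code_def by (auto simp del: rk.simps)

lemma rk_end_ext:
  assumes "end_ext A A'" "end_ext B B'" "\<eta> \<in> dclp A B"
  shows "rk (dclp A' B') \<eta> = rk (dclp A B) \<eta>"
  by (rule rk_cong) (use dclp_end_ext[OF assms] in \<open>auto simp: set_eq_iff\<close>)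

text \<open>Under end-extension a decided point keeps its status, its rank and its leader. This is
  why a pair of stems settles bits once and for all.\<close>

lemma code_mono:
  assumes "end_ext A A'" "end_ext B B'"
  shows "code A B \<subseteq>\<^sub>m code A' B'"
proof (unfold map_le_def, intro ballI)
  fix i assume "i \<in> dom (code A B)"
  then obtain \<eta> where \<eta>: "\<eta> \<in> dclp A B" "i = rk (dclp A B) \<eta>" unfolding dom_code by blast
  then have "\<eta> \<in> dclp A' B'" using dclp_end_ext[OF assms] by blast
  then show "code A B i = code A' B' i"
    using code_rk[OF \<eta>(1)] code_rk[of \<eta> A' B'] rk_end_ext[OF assms \<eta>(1)] leads_end_ext[OF assms \<eta>(1)] \<eta>(2)
    by simp
qed

text \<open>A single new decided point above all old ones receives as rank the order type of the old
  ones, which is the first index still free.\<close>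

lemma code_insert:
  assumes ext: "end_ext A A'" "end_ext B B'"
    and L: "dclp A' B' = insert \<eta> (dclp A B)" "\<forall>\<zeta>\<in>dclp A B. \<zeta> < \<eta>"
    and i: "i \<notin> dom (code A B)" "{..<i} \<subseteq> dom (code A B)"
  shows "code A' B' = (code A B)(i \<mapsto> leads A' B' \<eta>)"
proof -
  \<comment> \<open>The domain of a code is an initial segment; as \<open>i\<close> is its least
    missing index, the old ranks are exactly the ordinals below \<open>i\<close>.\<close>
  have ran: "rk (dclp A B) ` dclp A B = {..<i}"
    using i code_initial[of _ A B i] unfolding dom_code[symmetric] by (auto simp: not_less[symmetric]) (metis domI linorder_cases domIff)
  \<comment> \<open>The decided points below \<eta> are the old ones, and these keep their old
    ranks.\<close>
  have "rk (dclp A' B') \<eta> = (LEAST j. \<forall>\<zeta>\<in>dclp A B. rk (dclp A B) \<zeta> < j)"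
    unfolding rk.simps[of _ \<eta>] using L rk_end_ext[OF ext]
    by (intro arg_cong[where f = Least]) (auto simp: fun_eq_iff)
  also have "\<dots> = (LEAST j. \<forall>k\<in>rk (dclp A B) ` dclp A B. k < j)" by simp
  also have "\<dots> = i" unfolding ran by (rule Least_equality) (auto simp: not_less[symmetric])
  finally have rk: "rk (dclp A' B') \<eta> = i" .
  have i': "code A' B' i = Some (leads A' B' \<eta>)" using code_rk[of \<eta> A' B'] L(1) rk by simp
  have "dom (code A' B') = insert i (dom (code A B))"
    unfolding dom_code using rk L(1) rk_end_ext[OF ext] by auto
  then have "code A' B' x = code A B x" if "x \<noteq> i" for x
    using code_mono[OF ext] that unfolding map_le_def by (metis domIff insertE)
  then show ?thesis using i' by auto
qed

text \<open>A limit point of \<open>B\<close> has elements of \<open>B\<close> between it and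
  anything below it. Elements lying above all of \<open>B\<close> therefore never sit below a limit
  point of \<open>B\<close>, and adding them to \<open>A\<close> creates no common limit
  point.\<close>

lemma clp_block:
  assumes "A \<subseteq> A'" "\<forall>x\<in>A' - A. \<forall>y\<in>B. y < x"
  shows "clp A' B = clp A B" "clp B A' = clp B A"
proof -
  have "\<eta> \<in> lim_pts A" if \<eta>: "\<eta> \<in> lim_pts A'" "\<eta> \<in> lim_pts B" for \<eta>
  proof -
    have "x \<in> A" if "x \<in> A'" "x < \<eta>" for x
    proof (rule ccontr)
      assume "x \<notin> A"
      moreover obtain y where "y \<in> B" "x < y" using \<eta>(2) \<open>x < \<eta>\<close> unfolding lim_pts_def by blast
      ultimately show False using assms(2) that(1) by (meson DiffI less_asym)
    qed
    then show ?thesis using \<eta>(1) unfolding lim_pts_def by blast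
  qed
  then show "clp A' B = clp A B" "clp B A' = clp B A"
    unfolding clp_def using lim_pts_mono[OF assms(1)] by blast+
qed

text \<open>Every common limit point below the common supremum \<eta> is already decided by
  cofinality, and none lies above \<eta>. So \<eta> is the one undecided point, the place where the
  next bit is to be written. The bound \<gamma> makes the least upper bound exist.\<close>

lemma interleaved_sup:
  assumes "interleaved A B" "\<forall>x\<in>A. x < \<gamma>"
  obtains \<eta> where "clp A B = insert \<eta> (dclp A B)" "\<forall>\<zeta>\<in>dclp A B. \<zeta> < \<eta>"
    "\<forall>x\<in>A. x < \<eta>" "\<forall>y\<in>B. y < \<eta>" "\<And>z. \<forall>x\<in>A. x < z \<Longrightarrow> \<eta> \<le> z"
proof -
  define \<eta> where "\<eta> = (LEAST z. \<forall>x\<in>A. x < z)"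
  have A: "\<forall>x\<in>A. x < \<eta>" unfolding \<eta>_def by (rule LeastI[of _ \<gamma>]) fact
  have least: "\<eta> \<le> z" if "\<forall>x\<in>A. x < z" for z unfolding \<eta>_def by (rule Least_le) fact
  have B: "\<forall>y\<in>B. y < \<eta>" using A assms(1) unfolding interleaved_def by (meson order.strict_trans)
  have cofA: "\<exists>x\<in>A. \<xi> < x" if "\<xi> < \<eta>" for \<xi>
  proof -
    obtain x where "x \<in> A" "\<xi> \<le> x" using least[of \<xi>] \<open>\<xi> < \<eta>\<close> by force
    \<comment> \<open>Going up through \<open>B\<close> and back to \<open>A\<close> turns the weak
      inequality into a strict one.\<close>
    then show ?thesis using assms(1) unfolding interleaved_def by (meson le_less_trans order.strict_trans)
  qed
  have cofB: "\<exists>x\<in>B. \<xi> < x" if "\<xi> < \<eta>" for \<xi>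
    using cofA[OF that] assms(1) unfolding interleaved_def by (meson order.strict_trans)
  obtain x0 where "x0 \<in> A" using assms(1) unfolding interleaved_def by blast
  then have "\<eta> \<in> clp A B"
    unfolding clp_def lim_pts_def using cofA cofB A B by blast
  moreover have "\<zeta> \<le> \<eta>" if "\<zeta> \<in> clp A B" for \<zeta>
  proof (rule leI, rule notI)
    assume "\<eta> < \<zeta>"
    then obtain x where "x \<in> A" "\<eta> < x" using \<open>\<zeta> \<in> clp A B\<close> unfolding clp_def lim_pts_def by blast
    with A show False by (meson less_asym)
  qed
  moreover have "\<zeta> \<in> dclp A B" if "\<zeta> \<in> clp A B" "\<zeta> < \<eta>" for \<zeta>
    using that cofA[OF that(2)] cofB[OF that(2)] unfolding dclp_def by (auto intro: less_imp_le)
  moreover have "\<zeta> < \<eta>" if "\<zeta> \<in> dclp A B" for \<zeta>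
    using that A unfolding dclp_def by (auto intro: le_less_trans)
  moreover have "dclp A B \<subseteq> clp A B" unfolding dclp_def by blast
  ultimately have "clp A B = insert \<eta> (dclp A B)" "\<forall>\<zeta>\<in>dclp A B. \<zeta> < \<eta>"
    by (auto simp: le_less)
  then show thesis using A B least by (rule that)
qed

section \<open>Sequences and trees\<close>

definition node :: "('k::wellorder \<rightharpoonup> 'k) \<Rightarrow> bool" where
  "node u \<longleftrightarrow> (\<exists>\<alpha>. dom u = {..<\<alpha>}) \<and>
     (\<forall>\<xi> \<zeta> x y. u \<xi> = Some x \<and> u \<zeta> = Some y \<and> \<xi> < \<zeta> \<longrightarrow> x < y)"

lemma lh_eq: "dom u = {..<\<alpha>} \<Longrightarrow> lh u = \<alpha>"
  unfolding lh_def by (rule Least_equality) (auto simp: not_less[symmetric])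

lemma dom_node: "node u \<Longrightarrow> dom u = {..<lh u}"
  unfolding node_def using lh_eq by metis

lemma ran_mono: "u \<subseteq>\<^sub>m v \<Longrightarrow> ran u \<subseteq> ran v"
  unfolding map_le_def ran_def by (auto simp: dom_def) metis

lemma node_comparable:
  assumes "node u" "node v" "u \<subseteq>\<^sub>m w" "v \<subseteq>\<^sub>m w"
  shows "u \<subseteq>\<^sub>m v \<or> v \<subseteq>\<^sub>m u"
proof -
  have "u \<subseteq>\<^sub>m v" if "lh u \<le> lh v" "node u" "node v" "u \<subseteq>\<^sub>m w" "v \<subseteq>\<^sub>m w" for u v
    using that dom_node[of u] dom_node[of v] unfolding map_le_def
    by (metis lessThan_iff less_le_trans)
  then show ?thesis using assms linear[of "lh u" "lh v"] by blast
qed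

lemma map_le_lh:
  assumes "node u" "node v" "u \<subseteq>\<^sub>m v \<or> v \<subseteq>\<^sub>m u" "lh u \<le> lh v"
  shows "u \<subseteq>\<^sub>m v"
proof -
  have "dom u \<subseteq> dom v" using dom_node[OF assms(1)] dom_node[OF assms(2)] assms(4) by auto
  then show ?thesis using assms(3) unfolding map_le_def by (metis subsetD)
qed

lemma restrict_node:
  assumes "node u" "u \<subseteq>\<^sub>m v"
  shows "v |` {..<lh u} = u"
proof
  fix x show "(v |` {..<lh u}) x = u x"
    using assms(2) unfolding map_le_def restrict_map_def dom_node[OF assms(1), symmetric]
    by (metis domIff)
qed

text \<open>The bridge from sequences to sets: positions beyond the shorter domain come later, and
  in an increasing sequence they carry larger values.\<close>

lemma node_end_ext:
  assumes "node u" "node v" "u \<subseteq>\<^sub>m v"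
  shows "end_ext (ran u) (ran v)"
  unfolding end_ext_def
proof (intro conjI ballI)
  show "ran u \<subseteq> ran v" using ran_mono assms(3) .
  fix x y assume "x \<in> ran u" "y \<in> ran v - ran u"
  then obtain \<xi> \<zeta> where \<xi>: "u \<xi> = Some x" and \<zeta>: "v \<zeta> = Some y" unfolding ran_def by blast
  have "\<zeta> \<notin> dom u"
    using \<zeta> \<open>y \<in> ran v - ran u\<close> assms(3) unfolding map_le_def ran_def by force
  moreover have "\<xi> \<in> dom u" using \<xi> by blast
  ultimately have "\<xi> < \<zeta>" using dom_node[OF assms(1)] by (auto simp: not_less intro: less_le_trans)
  moreover have "v \<xi> = Some x" using \<xi> assms(3) \<open>\<xi> \<in> dom u\<close> unfolding map_le_def by metis
  ultimately show "x < y" using \<zeta> assms(2) unfolding node_def by blast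
qed

lemma snoc_map_le:
  assumes "node u" shows "u \<subseteq>\<^sub>m snoc u \<beta>"
  using dom_node[OF assms] unfolding snoc_def map_le_def by auto

lemma MI_node:
  assumes "T \<in> MI F" "u \<in> T"
  shows "node u"
proof -
  have mono: "strict_mono_on (dom u) (\<lambda>\<xi>. the (u \<xi>))" and "T \<subseteq> (\<Union>\<alpha>. seqs \<alpha>)"
    using assms unfolding MI_def is_tree_def by blast+
  then have "\<exists>\<alpha>. dom u = {..<\<alpha>}" using assms(2) unfolding seqs_def by blast
  moreover have "x < y" if "u \<xi> = Some x" "u \<zeta> = Some y" "\<xi> < \<zeta>" for \<xi> \<zeta> x y
    using strict_mono_onD[OF mono, of \<xi> \<zeta>] that by (simp add: domI)
  ultimately show ?thesis unfolding node_def by blast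
qed

lemma MI_restrict: "T \<in> MI F \<Longrightarrow> u \<in> T \<Longrightarrow> u |` {..<\<beta>} \<in> T"
  unfolding MI_def is_tree_def by blast

lemma MI_splits: "T \<in> MI F \<Longrightarrow> u \<in> T \<Longrightarrow> \<exists>v. splits F T v \<and> u \<subseteq>\<^sub>m v"
  unfolding MI_def by blast

lemma MI_nonempty: "T \<in> MI F \<Longrightarrow> T \<noteq> {}"
  unfolding MI_def is_tree_def by blast

lemma MI_splits_ex: "T \<in> MI F \<Longrightarrow> \<exists>u. splits F T u"
  using MI_nonempty[of T F] MI_splits[of T F] by blast

lemma splits_in: "splits F T u \<Longrightarrow> u \<in> T"
  unfolding splits_def by blast

lemma splits_mono: "S \<subseteq> T \<Longrightarrow> splits F S u \<Longrightarrow> splits F T u"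
  unfolding splits_def succs_def by (auto elim: eventually_mono)

lemma MI_limit_splits:
  assumes "T \<in> MI F" "limit_ordinal \<alpha>" "dom u = {..<\<alpha>}"
    "\<And>\<gamma>. \<gamma> < \<alpha> \<Longrightarrow> \<exists>\<beta>. \<gamma> \<le> \<beta> \<and> \<beta> < \<alpha> \<and> splits F T (u |` {..<\<beta>})"
  shows "splits F T u"
  using assms unfolding MI_def seqs_def by blast

section \<open>Regularity, unions of chains of splitting nodes, and final segments in the
  filter\<close>

locale kappa_filter =
  fixes F :: "'k::wellorder filter"
  assumes inaccessible: "strongly_inaccessible {(\<alpha>, \<beta>). \<alpha> \<le> (\<beta> :: 'k)}"
    and proper: "F \<noteq> bot"
    and complete: "kappa_complete F"
begin

lemma Field_le: "Field {(\<alpha>, \<beta>). \<alpha> \<le> (\<beta> :: 'k)} = UNIV"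
  by (auto simp: Field_def)

lemma card_order: "Card_order {(\<alpha>, \<beta>). \<alpha> \<le> (\<beta> :: 'k)}"
  using inaccessible unfolding strongly_inaccessible_def by blast

lemma card_ordIso: "|UNIV :: 'k set| =o {(\<alpha>, \<beta>). \<alpha> \<le> (\<beta> :: 'k)}"
  using card_of_Field_ordIso[OF card_order] unfolding Field_le .

lemma small_nat: "|UNIV :: nat set| <o |UNIV :: 'k set|"
proof -
  have "natLeq <o {(\<alpha>, \<beta>). \<alpha> \<le> (\<beta> :: 'k)}"
    using inaccessible unfolding strongly_inaccessible_def by blast
  then show ?thesis
    using card_of_nat card_ordIso ordIso_ordLess_trans ordLess_ordIso_trans ordIso_symmetric by blast
qed

lemma infinite_kappa: "infinite (UNIV :: 'k set)"
  using small_nat card_of_ordLeq_infinite[of "UNIV :: nat set"] ordLess_imp_ordLeq by blast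

lemma small_segment: "|{..<\<alpha> :: 'k}| <o |UNIV :: 'k set|"
proof -
  have "underS {(\<alpha>, \<beta>). \<alpha> \<le> (\<beta> :: 'k)} \<alpha> = {..<\<alpha>}" unfolding underS_def by auto
  then have "|{..<\<alpha>}| <o {(\<alpha>, \<beta>). \<alpha> \<le> (\<beta> :: 'k)}"
    using card_of_underS[OF card_order, of \<alpha>] Field_le by simp
  then show ?thesis using card_ordIso ordLess_ordIso_trans ordIso_symmetric by blast
qed

lemma no_max: "\<exists>\<beta>. (\<alpha> :: 'k) < \<beta>"
  using infinite_Card_order_limit[OF card_order, of \<alpha>] infinite_kappa unfolding Field_le
  by (auto simp: less_le)

text \<open>Lets closed initial segments be treated as open ones, both for their size and as domains
  of sequences.\<close>

lemma successor:
  obtains \<beta> where "{..<\<beta>} = {..(\<alpha> :: 'k)}"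
proof
  have "\<alpha> < (LEAST \<beta>. \<alpha> < \<beta>)" using no_max by (rule LeastI_ex)
  then show "{..<LEAST \<beta>. \<alpha> < \<beta>} = {..\<alpha>}"
    using not_less_Least[of _ "\<lambda>\<beta>. \<alpha> < \<beta>"] by (force simp: not_less)
qed

text \<open>This is regularity: an unbounded set would be cofinal and hence of full
  cardinality.\<close>

lemma small_bounded:
  assumes "|A :: 'k set| <o |UNIV :: 'k set|"
  obtains \<gamma> where "\<forall>x\<in>A. x < \<gamma>"
proof -
  have "regularCard {(\<alpha>, \<beta>). \<alpha> \<le> (\<beta> :: 'k)}"
    using inaccessible unfolding strongly_inaccessible_def by blast
  moreover have "\<not> |A| =o {(\<alpha>, \<beta>). \<alpha> \<le> (\<beta> :: 'k)}"
    using assms card_ordIso not_ordLess_ordIso ordIso_symmetric ordIso_transitive by blast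
  ultimately have "\<not> cofinal A {(\<alpha>, \<beta>). \<alpha> \<le> (\<beta> :: 'k)}"
    unfolding regularCard_def Field_le by blast
  then obtain a where "\<forall>x\<in>A. x \<le> a" unfolding cofinal_def Field_le by force
  moreover obtain \<gamma> where "a < \<gamma>" using no_max by blast
  ultimately have "\<forall>x\<in>A. x < \<gamma>" by (blast intro: le_less_trans)
  then show thesis by (rule that)
qed

lemma small_image: "|A| <o |UNIV :: 'k set| \<Longrightarrow> |f ` A| <o |UNIV :: 'k set|"
  using card_of_image ordLeq_ordLess_trans by blast

lemma small_subset: "A \<subseteq> B \<Longrightarrow> |B| <o |UNIV :: 'k set| \<Longrightarrow> |A| <o |UNIV :: 'k set|"
  using card_of_mono1 ordLeq_ordLess_trans by blast

lemma node_ran_bounded: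
  fixes u :: "'k \<rightharpoonup> 'k"
  assumes "node u"
  obtains \<gamma> where "\<forall>x\<in>ran u. x < \<gamma>"
proof -
  have "ran u = (\<lambda>\<xi>. the (u \<xi>)) ` {..<lh u}"
    unfolding dom_node[OF assms, symmetric] ran_def by force
  then show thesis using small_bounded small_image[OF small_segment] that by metis
qed

text \<open>If the chain has a largest member, that member serves. Otherwise the union has limit
  length with splitting restrictions cofinal in it, so it splits by clause (3) of the forcing. The
  range is recorded because codes depend on ranges alone.\<close>

lemma chain_union:
  assumes T: "T \<in> MI F" and C: "C \<noteq> {}" "|C| <o |UNIV :: 'k set|" "\<And>u. u \<in> C \<Longrightarrow> splits F T u"
    and chain: "\<And>u v. u \<in> C \<Longrightarrow> v \<in> C \<Longrightarrow> u \<subseteq>\<^sub>m v \<or> v \<subseteq>\<^sub>m u"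
  shows "\<exists>w. splits F T w \<and> (\<forall>u\<in>C. u \<subseteq>\<^sub>m w) \<and> ran w = (\<Union>u\<in>C. ran u)"
proof (cases "\<exists>w\<in>C. \<forall>u\<in>C. u \<subseteq>\<^sub>m w")
  case True
  then obtain w where "w \<in> C" "\<forall>u\<in>C. u \<subseteq>\<^sub>m w" by blast
  moreover have "ran w = (\<Union>u\<in>C. ran u)" using calculation ran_mono by blast
  ultimately show ?thesis using C(3) by blast
next
  case False
  have node: "node u" if "u \<in> C" for u using MI_node[OF T splits_in] C(3) that by blast
  \<comment> \<open>By regularity the lengths are bounded, so the union is undefined at some
    \<gamma> and its length \<alpha> below exists.\<close>
  obtain \<gamma> where \<gamma>: "\<forall>x\<in>lh ` C. x < \<gamma>" using small_bounded small_image[OF C(2)] by blast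
  have \<gamma>: "\<gamma> \<notin> dom u" if "u \<in> C" for u
  proof -
    have "lh u < \<gamma>" using \<gamma> that by blast
    then show ?thesis unfolding dom_node[OF node[OF that]] by auto
  qed
  \<comment> \<open>The member chosen at \<open>x\<close> is immaterial, since members of the chain
    agree where both are defined.\<close>
  define w where "w x = (if \<exists>u\<in>C. x \<in> dom u then (SOME u. u \<in> C \<and> x \<in> dom u) x else None)" for x
  have w_eq: "w x = u x" if "u \<in> C" "x \<in> dom u" for u x
  proof -
    define v where "v = (SOME u. u \<in> C \<and> x \<in> dom u)"
    have "v \<in> C \<and> x \<in> dom v" unfolding v_def by (rule someI[of _ u]) (use that in blast)
    moreover have "w x = v x" using that unfolding w_def v_def by auto
    ultimately show ?thesis using chain[of u v] that unfolding map_le_def by metis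
  qed
  then have le: "u \<subseteq>\<^sub>m w" if "u \<in> C" for u using that unfolding map_le_def by simp
  have dom: "\<exists>u\<in>C. x \<in> dom u" if "x \<in> dom w" for x
    using that unfolding w_def by (auto simp: dom_def split: if_splits)
  define \<alpha> where "\<alpha> = (LEAST \<alpha>. \<alpha> \<notin> dom w)"
  have "\<alpha> \<notin> dom w" unfolding \<alpha>_def by (rule LeastI[of _ \<gamma>]) (use dom \<gamma> in blast)
  have dom_w: "dom w = {..<\<alpha>}"
  proof (intro equalityI subsetI)
    fix x assume "x \<in> {..<\<alpha>}"
    then show "x \<in> dom w" using not_less_Least unfolding \<alpha>_def by blast
  next
    fix x assume "x \<in> dom w"
    then obtain u where u: "u \<in> C" "x \<in> dom u" using dom by blast
    then have "x < lh u" using dom_node[OF node[OF u(1)]] by simp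
    have "\<alpha> \<notin> dom u" using \<open>\<alpha> \<notin> dom w\<close> map_le_implies_dom_le[OF le[OF u(1)]] by (rule contra_subsetD[rotated])
    then have "lh u \<le> \<alpha>" unfolding dom_node[OF node[OF u(1)]] by simp
    with \<open>x < lh u\<close> show "x \<in> {..<\<alpha>}" by simp
  qed
  \<comment> \<open>No member is largest, so each is properly extended inside the chain and is
    strictly shorter than the union.\<close>
  have lh: "lh u < \<alpha>" if u: "u \<in> C" for u
  proof -
    obtain v where v: "v \<in> C" "\<not> v \<subseteq>\<^sub>m u" using False u by blast
    then have "lh u < lh v"
      using map_le_lh[OF node[OF v(1)] node[OF u]] chain[OF v(1) u] by (meson not_less)
    then have "lh u \<in> dom v" using dom_node[OF node[OF v(1)]] by simp
    then show ?thesis using dom_w map_le_implies_dom_le[OF le[OF v(1)]] by auto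
  qed
  have ex: "\<exists>u\<in>C. \<beta> < lh u" if \<beta>: "\<beta> < \<alpha>" for \<beta>
  proof -
    have "\<beta> \<in> dom w" using \<beta> dom_w by simp
    then obtain u where "u \<in> C" "\<beta> \<in> dom u" using dom by blast
    then show ?thesis using dom_node[OF node] by auto
  qed
  have "limit_ordinal \<alpha>"
    unfolding limit_ordinal_def using lh ex C(1) by blast
  then have "splits F T w"
  proof (rule MI_limit_splits[OF T _ dom_w])
    fix \<beta> assume "\<beta> < \<alpha>"
    then obtain u where u: "u \<in> C" "\<beta> < lh u" using ex by blast
    have "splits F T (w |` {..<lh u})" using restrict_node[OF node le] C(3) u(1) by simp
    moreover have "\<beta> \<le> lh u" using u(2) by simp
    ultimately show "\<exists>\<beta>'. \<beta> \<le> \<beta>' \<and> \<beta>' < \<alpha> \<and> splits F T (w |` {..<\<beta>'})"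
      using lh[OF u(1)] by blast
  qed
  moreover have "ran w \<subseteq> (\<Union>u\<in>C. ran u)"
  proof
    fix y assume "y \<in> ran w"
    then obtain x where x: "w x = Some y" unfolding ran_def by blast
    then obtain u where u: "u \<in> C" "x \<in> dom u" using dom by blast
    then have "y \<in> ran u" using w_eq[OF u] x by (auto intro: ranI)
    with u(1) show "y \<in> (\<Union>u\<in>C. ran u)" by blast
  qed
  moreover have "(\<Union>u\<in>C. ran u) \<subseteq> ran w" using ran_mono le by blast
  ultimately show ?thesis using le by blast
qed

text \<open>
  If some point \<open>b\<close> belonged to every set in \<open>F\<close>, then the values along a branch of a
  condition could never exceed \<open>b\<close>, since \<open>b\<close> is a successor of every splitting node.
\<close>

lemma MI_nonempty_cobounded:
  assumes "nonprincipal F" "T \<in> MI F"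
  shows "\<forall>\<^sub>F \<beta> in F. \<alpha> < \<beta>"
proof -
  have Inter: "\<forall>\<^sub>F \<beta> in F. \<beta> \<in> \<Inter>\<X>" if "|\<X>| <o |UNIV :: 'k set|" "\<And>X. X \<in> \<X> \<Longrightarrow> \<forall>\<^sub>F \<beta> in F. \<beta> \<in> X" for \<X>
    using complete that unfolding kappa_complete_def by blast
  have remove: "\<forall>\<^sub>F \<beta> in F. \<forall>x\<in>A. \<beta> \<noteq> x"
    if A: "|A| <o |UNIV :: 'k set|" "\<And>x. x \<in> A \<Longrightarrow> \<forall>\<^sub>F \<beta> in F. \<beta> \<noteq> x" for A
  proof -
    have "\<forall>\<^sub>F \<beta> in F. \<beta> \<in> \<Inter>((\<lambda>x. - {x}) ` A)"
      by (rule Inter) (use A small_image in auto)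
    then show ?thesis by (rule eventually_mono) auto
  qed
  have small_le: "|{..x}| <o |UNIV :: 'k set|" for x :: 'k
    using successor small_segment by metis
  have single: "\<forall>\<^sub>F \<beta> in F. \<beta> \<noteq> b" for b
  proof (rule ccontr)
    assume b: "\<not> (\<forall>\<^sub>F \<beta> in F. \<beta> \<noteq> b)"
    have in_b: "b \<in> X" if "\<forall>\<^sub>F \<beta> in F. \<beta> \<in> X" for X
    proof (rule ccontr)
      assume "b \<notin> X"
      with that have "\<forall>\<^sub>F \<beta> in F. \<beta> \<noteq> b" by (auto elim: eventually_mono)
      with b show False ..
    qed
    obtain v where v: "splits F T v" using MI_nonempty MI_splits assms(2) by blast
    have node_v: "node v" using MI_node splits_in v assms(2) by blast
    \<comment> \<open>Otherwise there are few successors. By completeness, those that some set of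
      the filter omits can be removed together; the remaining set \<open>Y\<close> lies in the
      filter and is contained in all its members, which makes the filter principal.\<close>
    have "\<exists>\<beta>\<in>succs T v. b < \<beta>"
    proof (rule ccontr)
      assume "\<not> (\<exists>\<beta>\<in>succs T v. b < \<beta>)"
      moreover define Y where "Y = {x \<in> succs T v. \<not> (\<forall>\<^sub>F \<beta> in F. \<beta> \<noteq> x)}"
      ultimately have "|succs T v - Y| <o |UNIV :: 'k set|"
        by (intro small_subset[OF _ small_le[of b]]) (auto simp: not_less)
      then have "\<forall>\<^sub>F \<beta> in F. \<forall>x\<in>succs T v - Y. \<beta> \<noteq> x"
        by (rule remove) (auto simp: Y_def)
      moreover have "\<forall>\<^sub>F \<beta> in F. \<beta> \<in> succs T v" using v unfolding splits_def by blast
      ultimately have Y: "\<forall>\<^sub>F \<beta> in F. \<beta> \<in> Y" by eventually_elim blast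
      have "F = principal Y"
      proof (rule antisym)
        show "F \<le> principal Y" using Y by (simp add: le_principal)
        show "principal Y \<le> F"
        proof (rule filter_leI)
          fix Q assume Q: "eventually Q F"
          have "Q x" if "x \<in> Y" for x
          proof (rule ccontr)
            assume "\<not> Q x"
            with Q have "\<forall>\<^sub>F \<beta> in F. \<beta> \<noteq> x" by (auto elim: eventually_mono)
            with that show False unfolding Y_def by blast
          qed
          then show "eventually Q (principal Y)" by (simp add: eventually_principal)
        qed
      qed
      then show False using assms(1) unfolding nonprincipal_def by blast
    qed
    then obtain \<beta> where \<beta>: "snoc v \<beta> \<in> T" "b < \<beta>" unfolding succs_def by blast
    \<comment> \<open>Above this successor pick a splitting node \<open>w\<close>. It has already
      taken the value \<beta> above \<open>b\<close>, yet \<open>b\<close> must still be a successor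
      of it, which contradicts strict increase.\<close>
    obtain w where w: "splits F T w" "snoc v \<beta> \<subseteq>\<^sub>m w" using MI_splits[OF assms(2) \<beta>(1)] by blast
    have node_w: "node w" using MI_node splits_in w assms(2) by blast
    have "b \<in> succs T w" using in_b w(1) unfolding splits_def by blast
    then have node: "node (snoc w b)" using MI_node assms(2) unfolding succs_def by blast
    have "snoc v \<beta> (lh v) = Some \<beta>" unfolding snoc_def by simp
    then have "w (lh v) = Some \<beta>" using w(2) unfolding map_le_def by force
    moreover have "lh v < lh w" using calculation dom_node[OF node_w] by blast
    ultimately have "snoc w b (lh v) = Some \<beta>" "snoc w b (lh w) = Some b"
      unfolding snoc_def by auto
    then have "\<beta> < b" using node \<open>lh v < lh w\<close> unfolding node_def by blast
    with \<beta>(2) show False by (meson less_asym)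
  qed
  have "\<forall>\<^sub>F \<beta> in F. \<forall>x\<in>{..\<alpha>}. \<beta> \<noteq> x" by (rule remove[OF small_le single])
  then show ?thesis by (rule eventually_mono) (auto simp: not_less[symmetric])
qed

end

section \<open>Alternating extension of two stems\<close>

text \<open>One round in which the first stem moves beyond the second and then the second beyond the
  new first. The last two clauses force growth past everything used so far, so that \<omega> rounds
  yield interleaved ranges.\<close>

definition advance :: "('k::wellorder \<rightharpoonup> 'k) \<times> ('k \<rightharpoonup> 'k) \<Rightarrow> ('k \<rightharpoonup> 'k) \<times> ('k \<rightharpoonup> 'k) \<Rightarrow> bool" where
  "advance = (\<lambda>(s, t) (s', t'). s \<subseteq>\<^sub>m s' \<and> t \<subseteq>\<^sub>m t'
     \<and> (\<forall>x\<in>ran s' - ran s. \<forall>z\<in>ran t. z < x) \<and> (\<forall>y\<in>ran t' - ran t. \<forall>z\<in>ran s'. z < y)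
     \<and> (\<exists>x\<in>ran s'. \<forall>z\<in>ran s \<union> ran t. z < x) \<and> (\<exists>y\<in>ran t'. \<forall>z\<in>ran s' \<union> ran t. z < y))"

locale cobounded_filter = kappa_filter F for F :: "'k::wellorder filter" +
  assumes cobounded: "\<forall>\<^sub>F \<beta> in F. \<alpha> < \<beta>"
begin

text \<open>The successor set of a splitting node meets every final segment, so a next value \<beta>
  can be taken above any bound on the two ranges. By strict increase every later value is at least
  \<beta>, so the path can run on to a splitting node.\<close>

lemma extend_above:
  assumes S: "S \<in> MI F" and s: "splits F S s" and t: "node t"
  shows "\<exists>s'. splits F S s' \<and> s \<subseteq>\<^sub>m s' \<and> (\<forall>x\<in>ran s' - ran s. \<forall>z\<in>ran s \<union> ran t. z < x)
    \<and> (\<exists>x\<in>ran s'. \<forall>z\<in>ran s \<union> ran t. z < x)"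
proof -
  have node_s: "node s" using MI_node[OF S splits_in[OF s]] .
  obtain \<gamma>1 \<gamma>2 where \<gamma>: "\<forall>x\<in>ran s. x < \<gamma>1" "\<forall>x\<in>ran t. x < \<gamma>2"
    using node_ran_bounded[OF node_s] node_ran_bounded[OF t] by metis
  define m where "m = max \<gamma>1 \<gamma>2"
  have m: "\<forall>z\<in>ran s \<union> ran t. z < m" using \<gamma> unfolding m_def by (auto simp: less_max_iff_disj)
  have "\<forall>\<^sub>F \<beta> in F. \<beta> \<in> succs S s \<and> m < \<beta>"
    using s cobounded unfolding splits_def by (intro eventually_conj) auto
  then obtain \<beta> where \<beta>: "snoc s \<beta> \<in> S" "m < \<beta>"
    using eventually_happens'[OF proper] unfolding succs_def by blast
  obtain v where v: "splits F S v" "snoc s \<beta> \<subseteq>\<^sub>m v" using MI_splits[OF S \<beta>(1)] by blast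
  have node_v: "node v" using MI_node[OF S splits_in[OF v(1)]] .
  have sv: "s \<subseteq>\<^sub>m v" using snoc_map_le[OF node_s] v(2) map_le_trans by blast
  have "snoc s \<beta> (lh s) = Some \<beta>" unfolding snoc_def by simp
  then have v_lh: "v (lh s) = Some \<beta>" using v(2) unfolding map_le_def by force
  have "m < x" if x: "x \<in> ran v - ran s" for x
  proof -
    obtain \<xi> where \<xi>: "v \<xi> = Some x" using x unfolding ran_def by blast
    have "\<xi> \<notin> dom s" using \<xi> x sv unfolding map_le_def ran_def by force
    then have "lh s \<le> \<xi>" unfolding dom_node[OF node_s] by simp
    then show ?thesis
    proof (cases "lh s = \<xi>")
      case True
      then show ?thesis using \<xi> v_lh \<beta>(2) by simp
    next
      case False
      then have "lh s < \<xi>" using \<open>lh s \<le> \<xi>\<close> by simp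
      then have "\<beta> < x" using node_v \<xi> v_lh unfolding node_def by blast
      then show ?thesis using \<beta>(2) by (rule less_trans[rotated])
    qed
  qed
  then have "\<forall>x\<in>ran v - ran s. \<forall>z\<in>ran s \<union> ran t. z < x" using m by (meson less_trans)
  moreover have "\<beta> \<in> ran v" using v_lh by (rule ranI)
  moreover have "\<forall>z\<in>ran s \<union> ran t. z < \<beta>" using m \<beta>(2) by (meson less_trans)
  ultimately show ?thesis using v(1) sv by blast
qed

lemma advance_exists:
  assumes S: "S \<in> MI F" "splits F S s" and T: "T \<in> MI F" "splits F T t"
  shows "\<exists>s' t'. splits F S s' \<and> splits F T t' \<and> advance (s, t) (s', t')"
proof -
  have "node t" using MI_node[OF T(1) splits_in[OF T(2)]] .
  obtain s' where s': "splits F S s'" "s \<subseteq>\<^sub>m s'" "\<forall>x\<in>ran s' - ran s. \<forall>z\<in>ran s \<union> ran t. z < x"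
      "\<exists>x\<in>ran s'. \<forall>z\<in>ran s \<union> ran t. z < x"
    using extend_above[OF S \<open>node t\<close>] by blast
  have "node s'" using MI_node[OF S(1) splits_in[OF s'(1)]] .
  obtain t' where t': "splits F T t'" "t \<subseteq>\<^sub>m t'" "\<forall>x\<in>ran t' - ran t. \<forall>z\<in>ran t \<union> ran s'. z < x"
      "\<exists>x\<in>ran t'. \<forall>z\<in>ran t \<union> ran s'. z < x"
    using extend_above[OF T \<open>node s'\<close>] by blast
  have "advance (s, t) (s', t')" unfolding advance_def prod.case
    using s'(2-) t'(2-) by (simp add: Un_commute)
  with s'(1) t'(1) show ?thesis by blast
qed

text \<open>Run \<omega> rounds of \<open>advance\<close> and take unions. No finite round creates a
  common limit point, while every common limit point present at the start gets decided. The new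
  common supremum remains undecided.\<close>

lemma alternate:
  assumes S: "S \<in> MI F" "splits F S s" and T: "T \<in> MI F" "splits F T t"
  obtains s' t' where "splits F S s'" "splits F T t'" "s \<subseteq>\<^sub>m s'" "t \<subseteq>\<^sub>m t'"
    "interleaved (ran s') (ran t')" "dclp (ran s') (ran t') = clp (ran s) (ran t)"
    "\<forall>x\<in>ran s' - ran s. \<forall>z\<in>ran t. z < x" "\<forall>y\<in>ran t' - ran t. \<forall>z\<in>ran s. z < y"
proof -
  \<comment> \<open>Dependent choice; the clause for \<open>n = 0\<close> pins the sequence to the
    given stems.\<close>
  have "\<exists>f. \<forall>n. ((splits F S (fst (f n)) \<and> splits F T (snd (f n))) \<and> (n = 0 \<longrightarrow> f n = (s, t)))
      \<and> advance (f n) (f (Suc n))"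
  proof (rule dependent_nat_choice)
    show "\<exists>x. (splits F S (fst x) \<and> splits F T (snd x)) \<and> ((0::nat) = 0 \<longrightarrow> x = (s, t))"
      using S T by auto
    fix x and n :: nat assume "(splits F S (fst x) \<and> splits F T (snd x)) \<and> (n = 0 \<longrightarrow> x = (s, t))"
    then show "\<exists>y. ((splits F S (fst y) \<and> splits F T (snd y)) \<and> (Suc n = 0 \<longrightarrow> y = (s, t))) \<and> advance x y"
      using advance_exists[OF S(1) _ T(1), of "fst x" "snd x"] by force
  qed
  then obtain f where f: "\<And>n. splits F S (fst (f n))" "\<And>n. splits F T (snd (f n))" "f 0 = (s, t)"
      "\<And>n. advance (f n) (f (Suc n))"
    by blast
  define a where "a n = fst (f n)" for n
  define b where "b n = snd (f n)" for n
  have sp: "splits F S (a n)" "splits F T (b n)" for n using f unfolding a_def b_def by auto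
  have node: "node (a n)" "node (b n)" for n
    using MI_node[OF S(1) splits_in[OF sp(1)]] MI_node[OF T(1) splits_in[OF sp(2)]] by auto
  have st: "advance (a n, b n) (a (Suc n), b (Suc n))" for n using f(4)[of n] unfolding a_def b_def by simp
  have zero: "a 0 = s" "b 0 = t" using f(3) unfolding a_def b_def by auto
  have mono: "a n \<subseteq>\<^sub>m a m" "b n \<subseteq>\<^sub>m b m" if "n \<le> m" for n m
    using that
  proof (induction rule: dec_induct)
    case (step m)
    { case 1 show ?case using step.IH(1) st[of m] map_le_trans unfolding advance_def by blast }
    { case 2 show ?case using step.IH(2) st[of m] map_le_trans unfolding advance_def by blast }
  qed auto
  have small: "|range g| <o |UNIV :: 'k set|" for g :: "nat \<Rightarrow> 'k \<rightharpoonup> 'k"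
    using small_image[OF small_nat] .
  obtain s' where s': "splits F S s'" "\<And>n. a n \<subseteq>\<^sub>m s'" "ran s' = (\<Union>n. ran (a n))"
  proof -
    have "a n \<subseteq>\<^sub>m a m \<or> a m \<subseteq>\<^sub>m a n" for n m
      using mono(1) nat_le_linear by blast
    then have "\<exists>w. splits F S w \<and> (\<forall>u\<in>range a. u \<subseteq>\<^sub>m w) \<and> ran w = (\<Union>u\<in>range a. ran u)"
      using sp(1) by (intro chain_union[OF S(1) _ small]) auto
    then show thesis using that by auto
  qed
  obtain t' where t': "splits F T t'" "\<And>n. b n \<subseteq>\<^sub>m t'" "ran t' = (\<Union>n. ran (b n))"
  proof -
    have "b n \<subseteq>\<^sub>m b m \<or> b m \<subseteq>\<^sub>m b n" for n m
      using mono(2) nat_le_linear by blast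
    then have "\<exists>w. splits F T w \<and> (\<forall>u\<in>range b. u \<subseteq>\<^sub>m w) \<and> ran w = (\<Union>u\<in>range b. ran u)"
      using sp(2) by (intro chain_union[OF T(1) _ small]) auto
    then show thesis using that by auto
  qed
  have node': "node s'" "node t'"
    using MI_node[OF S(1) splits_in[OF s'(1)]] MI_node[OF T(1) splits_in[OF t'(1)]] by auto
  have ext: "end_ext (ran (a n)) (ran s')" "end_ext (ran (b n)) (ran t')" for n
    by (intro node_end_ext node node' s'(2) t'(2))+
  \<comment> \<open>Each half-round adds only values above the whole range of the other
    stem.\<close>
  have clp: "clp (ran (a n)) (ran (b n)) = clp (ran s) (ran t)" for n
  proof (induction n)
    case (Suc n)
    have "clp (ran (a (Suc n))) (ran (b n)) = clp (ran (a n)) (ran (b n))"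
      by (rule clp_block(1)) (use st[of n] ran_mono in \<open>auto simp: advance_def\<close>)
    moreover have "clp (ran (a (Suc n))) (ran (b (Suc n))) = clp (ran (a (Suc n))) (ran (b n))"
      by (rule clp_block(2)) (use st[of n] ran_mono in \<open>auto simp: advance_def\<close>)
    ultimately show ?case using Suc by simp
  qed (simp add: zero)
  have above: "\<exists>x\<in>ran s'. \<forall>z\<in>ran (a n) \<union> ran (b n). z < x"
      "\<exists>y\<in>ran t'. \<forall>z\<in>ran (a n) \<union> ran (b n). z < y" for n
  proof -
    obtain x where "x \<in> ran (a (Suc n))" "\<forall>z\<in>ran (a n) \<union> ran (b n). z < x"
      using st[of n] unfolding advance_def by blast
    then show "\<exists>x\<in>ran s'. \<forall>z\<in>ran (a n) \<union> ran (b n). z < x" using s'(3) by blast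
    obtain y where "y \<in> ran (b (Suc n))" "\<forall>z\<in>ran (a (Suc n)) \<union> ran (b n). z < y"
      using st[of n] unfolding advance_def by blast
    moreover have "ran (a n) \<subseteq> ran (a (Suc n))" using ran_mono mono(1)[of n "Suc n"] by simp
    ultimately show "\<exists>y\<in>ran t'. \<forall>z\<in>ran (a n) \<union> ran (b n). z < y" using t'(3) by blast
  qed
  have "interleaved (ran s') (ran t')"
    unfolding interleaved_def using above s'(3) t'(3) by (metis UN_iff UnI1 UnI2 empty_iff)
  moreover have "dclp (ran s') (ran t') = clp (ran s) (ran t)"
  proof (intro equalityI subsetI)
    fix \<zeta> assume "\<zeta> \<in> dclp (ran s') (ran t')"
    then obtain x y where xy: "\<zeta> \<in> clp (ran s') (ran t')" "x \<in> ran s'" "\<zeta> \<le> x" "y \<in> ran t'" "\<zeta> \<le> y"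
      unfolding dclp_def by blast
    then obtain n m where "x \<in> ran (a n)" "y \<in> ran (b m)" using s'(3) t'(3) by blast
    \<comment> \<open>Both deciding values occur at a common finite stage, where the common limit
      points are still the initial ones.\<close>
    then have "x \<in> ran (a (max n m))" "y \<in> ran (b (max n m))"
      using ran_mono[OF mono(1)[of n "max n m"]] ran_mono[OF mono(2)[of m "max n m"]] by auto
    then have "\<zeta> \<in> clp (ran (a (max n m))) (ran (b (max n m)))"
      using clp_end_ext[OF ext] xy by blast
    then show "\<zeta> \<in> clp (ran s) (ran t)" using clp by simp
  next
    fix \<zeta> assume \<zeta>: "\<zeta> \<in> clp (ran s) (ran t)"
    then have "\<zeta> \<in> clp (ran s') (ran t')"
      using lim_pts_mono ran_mono s'(2)[of 0] t'(2)[of 0] unfolding clp_def zero by blast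
    \<comment> \<open>A value above all of \<open>ran s\<close> is at or beyond each limit point of
      it, so the first round already decides \<zeta>.\<close>
    moreover have *: "\<zeta> \<le> x" if "\<forall>z\<in>ran s. z < x" for x
    proof (rule leI, rule notI)
      assume "x < \<zeta>"
      then obtain z where "z \<in> ran s" "x < z" using \<zeta> unfolding clp_def lim_pts_def by blast
      with that show False by (meson less_asym)
    qed
    ultimately show "\<zeta> \<in> dclp (ran s') (ran t')"
      using above[of 0] unfolding dclp_def zero by blast
  qed
  moreover have "\<forall>z\<in>ran t. z < x" if x: "x \<in> ran s' - ran s" for x
  proof -
    obtain n where "x \<in> ran (a n)" using x s'(3) by blast
    then show ?thesis
    proof (induction n)
      case 0
      with x zero show ?case by simp
    next
      case (Suc n)
      show ?case
      proof (cases "x \<in> ran (a n)")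
        case True
        then show ?thesis by (rule Suc.IH)
      next
        case False
        then have "\<forall>z\<in>ran (b n). z < x" using Suc.prems st[of n] unfolding advance_def by blast
        then show ?thesis using ran_mono[OF mono(2)[of 0 n]] zero by auto
      qed
    qed
  qed
  moreover have "\<forall>z\<in>ran s. z < y" if y: "y \<in> ran t' - ran t" for y
  proof -
    obtain n where "y \<in> ran (b n)" using y t'(3) by blast
    then show ?thesis
    proof (induction n)
      case 0
      with y zero show ?case by simp
    next
      case (Suc n)
      show ?case
      proof (cases "y \<in> ran (b n)")
        case True
        then show ?thesis by (rule Suc.IH)
      next
        case False
        then have "\<forall>z\<in>ran (a (Suc n)). z < y" using Suc.prems st[of n] unfolding advance_def by blast
        then show ?thesis using ran_mono[OF mono(1)[of 0 "Suc n"]] zero by auto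
      qed
    qed
  qed
  ultimately show thesis using that s'(1,2) t'(1,2) zero by metis
qed

end

text \<open>The full subtree through \<open>u\<close>: the usual strengthening of a tree condition
  that fixes \<open>u\<close> as an initial part of its branches.\<close>

definition cone :: "('k::wellorder \<rightharpoonup> 'k) set \<Rightarrow> ('k \<rightharpoonup> 'k) \<Rightarrow> ('k \<rightharpoonup> 'k) set" where
  "cone T u = {v \<in> T. v \<subseteq>\<^sub>m u \<or> u \<subseteq>\<^sub>m v}"

section \<open>Writing prescribed bits into a pair of stems\<close>

context cobounded_filter
begin

text \<open>The common supremum \<eta> of the two stems is the only undecided point. Whichever stem
  first moves past it fixes the bit there: the first stem for \<open>True\<close>, the second for
  \<open>False\<close>. Alternating afterwards decides \<eta> and no further point.\<close>

lemma append_bit: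
  assumes S: "S \<in> MI F" "splits F S s" and T: "T \<in> MI F" "splits F T t"
    and il: "interleaved (ran s) (ran t)"
    and i: "i \<notin> dom (code (ran s) (ran t))" "{..<i} \<subseteq> dom (code (ran s) (ran t))"
  obtains s' t' where "splits F S s'" "splits F T t'" "s \<subseteq>\<^sub>m s'" "t \<subseteq>\<^sub>m t'"
    "interleaved (ran s') (ran t')" "code (ran s') (ran t') = (code (ran s) (ran t))(i \<mapsto> b)"
proof -
  have node: "node s" "node t"
    using MI_node[OF S(1) splits_in[OF S(2)]] MI_node[OF T(1) splits_in[OF T(2)]] by auto
  obtain \<gamma> where "\<forall>x\<in>ran s. x < \<gamma>" using node_ran_bounded[OF node(1)] by blast
  then obtain \<eta> where \<eta>: "clp (ran s) (ran t) = insert \<eta> (dclp (ran s) (ran t))"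
      "\<forall>\<zeta>\<in>dclp (ran s) (ran t). \<zeta> < \<eta>" "\<forall>x\<in>ran s. x < \<eta>" "\<forall>y\<in>ran t. y < \<eta>"
      "\<And>z. \<forall>x\<in>ran s. x < z \<Longrightarrow> \<eta> \<le> z"
    using interleaved_sup[OF il] by blast
  obtain s' t' where st: "splits F S s'" "splits F T t'" "s \<subseteq>\<^sub>m s'" "t \<subseteq>\<^sub>m t'"
      "interleaved (ran s') (ran t')" "dclp (ran s') (ran t') = clp (ran s) (ran t)"
      "leads (ran s') (ran t') \<eta> = b"
  proof (cases b)
    case True
    obtain s1 where s1: "splits F S s1" "s \<subseteq>\<^sub>m s1" "\<forall>x\<in>ran s1 - ran s. \<forall>z\<in>ran s \<union> ran t. z < x"
        "\<exists>x\<in>ran s1. \<forall>z\<in>ran s \<union> ran t. z < x"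
      using extend_above[OF S node(2)] by blast
    obtain s' t' where st: "splits F S s'" "splits F T t'" "s1 \<subseteq>\<^sub>m s'" "t \<subseteq>\<^sub>m t'"
        "interleaved (ran s') (ran t')" "dclp (ran s') (ran t') = clp (ran s1) (ran t)"
        "\<forall>y\<in>ran t' - ran t. \<forall>z\<in>ran s1. z < y"
      using alternate[OF S(1) s1(1) T] by metis
    \<comment> \<open>The preliminary move stays above the other range, so it creates no common
      limit point.\<close>
    have "clp (ran s1) (ran t) = clp (ran s) (ran t)"
      by (rule clp_block(1)) (use s1 ran_mono in auto)
    moreover obtain x where x: "x \<in> ran s1" "\<eta> \<le> x" using s1(4) \<eta>(5) by blast
    have "x < y" if "y \<in> ran t'" "\<eta> \<le> y" for y
    proof -
      \<comment> \<open>A value from \<eta> on is new, and the new values of the second stem were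
        chosen above all of \<open>ran s1\<close>.\<close>
      have "y \<notin> ran t" using \<eta>(4) that(2) by (auto simp: not_less[symmetric])
      then show ?thesis using st(7) x(1) that(1) by blast
    qed
    then have "leads (ran s') (ran t') \<eta>"
      using x ran_mono[OF st(3)] unfolding leads_def by blast
    ultimately show thesis using st that[of s' t'] True map_le_trans[OF s1(2)] by auto
  next
    case False
    obtain t1 where t1: "splits F T t1" "t \<subseteq>\<^sub>m t1" "\<forall>x\<in>ran t1 - ran t. \<forall>z\<in>ran t \<union> ran s. z < x"
        "\<exists>x\<in>ran t1. \<forall>z\<in>ran t \<union> ran s. z < x"
      using extend_above[OF T node(1)] by blast
    obtain s' t' where st: "splits F S s'" "splits F T t'" "s \<subseteq>\<^sub>m s'" "t1 \<subseteq>\<^sub>m t'"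
        "interleaved (ran s') (ran t')" "dclp (ran s') (ran t') = clp (ran s) (ran t1)"
        "\<forall>x\<in>ran s' - ran s. \<forall>z\<in>ran t1. z < x"
      using alternate[OF S T(1) t1(1)] by metis
    have "clp (ran s) (ran t1) = clp (ran s) (ran t)"
      by (rule clp_block(2)) (use t1 ran_mono in auto)
    moreover obtain y where y: "y \<in> ran t1" "\<eta> \<le> y" using t1(4) \<eta>(5) by blast
    have "\<not> x < y" if "x \<in> ran s'" "\<eta> \<le> x" for x
    proof -
      have "x \<notin> ran s" using \<eta>(3) that(2) by (auto simp: not_less[symmetric])
      then have "y < x" using st(7) y(1) that(1) by blast
      then show ?thesis by simp
    qed
    then have "\<not> leads (ran s') (ran t') \<eta>"
      using y ran_mono[OF st(4)] unfolding leads_def by blast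
    ultimately show thesis using st that[of s' t'] False map_le_trans[OF t1(2)] by auto
  qed
  have node': "node s'" "node t'"
    using MI_node[OF S(1) splits_in[OF st(1)]] MI_node[OF T(1) splits_in[OF st(2)]] by auto
  have "code (ran s') (ran t') = (code (ran s) (ran t))(i \<mapsto> leads (ran s') (ran t') \<eta>)"
    by (rule code_insert[OF _ _ _ \<eta>(2) i])
      (use node_end_ext[OF node(1) node'(1) st(3)] node_end_ext[OF node(2) node'(2) st(4)] st(6) \<eta>(1) in auto)
  then show thesis using that st by simp
qed

text \<open>Transfinite recursion on the index: take the union of all earlier pairs, then append the
  bit \<open>g i\<close> if index \<open>i\<close> is still free. The agreement of the initial code
  with \<open>g\<close> persists, because unions of stems introduce no bits of their own.\<close>

lemma write_bits:
  assumes S: "S \<in> MI F" "splits F S s" and T: "T \<in> MI F" "splits F T t"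
    and il: "interleaved (ran s) (ran t)"
    and g: "\<And>j b. code (ran s) (ran t) j = Some b \<Longrightarrow> b = g j"
  obtains s' t' where "splits F S s'" "splits F T t'" "s \<subseteq>\<^sub>m s'" "t \<subseteq>\<^sub>m t'"
    "\<And>j. j < \<delta> \<Longrightarrow> code (ran s') (ran t') j = Some (g j)"
proof -
  define cd where "cd p = code (ran (fst p)) (ran (snd p))" for p :: "('k \<rightharpoonup> 'k) \<times> ('k \<rightharpoonup> 'k)"
  define le where "le p q \<longleftrightarrow> fst p \<subseteq>\<^sub>m fst q \<and> snd p \<subseteq>\<^sub>m snd q" for p q :: "('k \<rightharpoonup> 'k) \<times> ('k \<rightharpoonup> 'k)"
  define good where "good p \<longleftrightarrow> splits F S (fst p) \<and> splits F T (snd p) \<and> le (s, t) p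
    \<and> interleaved (ran (fst p)) (ran (snd p)) \<and> (\<forall>j b. cd p j = Some b \<longrightarrow> b = g j)" for p
  \<comment> \<open>Stage \<open>i\<close> extends all earlier stages and has bit \<open>i\<close>
    in its code.\<close>
  define P where "P f i p \<longleftrightarrow> good p \<and> (\<forall>j<i. le (f j) p) \<and> i \<in> dom (cd p)"
    for f :: "'k \<Rightarrow> ('k \<rightharpoonup> 'k) \<times> ('k \<rightharpoonup> 'k)" and i p
  have le_trans: "le p r" if "le p q" "le q r" for p q r
    using that map_le_trans unfolding le_def by blast
  have le_refl: "le p p" for p unfolding le_def by simp
  have node: "node (fst p)" "node (snd p)" if "good p" for p
    using that MI_node[OF S(1) splits_in] MI_node[OF T(1) splits_in] unfolding good_def by blast+
  have cd_mono: "cd p \<subseteq>\<^sub>m cd q" if "good p" "good q" "le p q" for p q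
    unfolding cd_def using that(3) node[OF that(1)] node[OF that(2)] unfolding le_def
    by (intro code_mono node_end_ext) auto
  have good0: "good (s, t)" unfolding good_def cd_def using S T il g le_refl by auto
  have "\<exists>f. \<forall>i. P f i (f i)"
  proof (rule dependent_wellorder_choice)
    fix f :: "'k \<Rightarrow> ('k \<rightharpoonup> 'k) \<times> ('k \<rightharpoonup> 'k)" and i
    assume "\<And>j. j < i \<Longrightarrow> P f j (f j)"
    then have f: "good (f j)" "\<And>k. k < j \<Longrightarrow> le (f k) (f j)" "j \<in> dom (cd (f j))" if "j < i" for j
      using that unfolding P_def by auto
    \<comment> \<open>Including the initial pair keeps the chain nonempty at the least stage and
      makes the union extend it.\<close>
    define U where "U = insert (s, t) (f ` {..<i})"
    have U_good: "good p" if "p \<in> U" for p using that f(1) good0 unfolding U_def by auto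
    have U_chain: "le p q \<or> le q p" if "p \<in> U" "q \<in> U" for p q
    proof -
      have "le (f j) (f k) \<or> le (f k) (f j)" if "j < i" "k < i" for j k
        using that f(2) le_refl by (cases j k rule: linorder_cases) auto
      moreover have "le (s, t) p" if "p \<in> U" for p using U_good[OF that] unfolding good_def by blast
      ultimately show ?thesis using that unfolding U_def by blast
    qed
    have "|U| <o |UNIV :: 'k set|"
      using card_of_Un_ordLess_infinite[OF infinite_kappa finite_card_less[OF _ infinite_kappa, of "{(s, t)}"]
          small_image[OF small_segment, of f i]] unfolding U_def by simp
    then have small: "|h ` U| <o |UNIV :: 'k set|" for h :: "_ \<Rightarrow> 'k \<rightharpoonup> 'k" by (rule small_image)
    have "U \<noteq> {}" unfolding U_def by blast
    have U_splits: "splits F S (fst p)" "splits F T (snd p)" if "p \<in> U" for p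
      using U_good[OF that] unfolding good_def by auto
    have U_chain': "fst p \<subseteq>\<^sub>m fst q \<or> fst q \<subseteq>\<^sub>m fst p" "snd p \<subseteq>\<^sub>m snd q \<or> snd q \<subseteq>\<^sub>m snd p"
      if "p \<in> U" "q \<in> U" for p q
      using U_chain[OF that] unfolding le_def by auto
    have "\<exists>w. splits F S w \<and> (\<forall>u\<in>fst ` U. u \<subseteq>\<^sub>m w) \<and> ran w = (\<Union>u\<in>fst ` U. ran u)"
      by (intro chain_union[OF S(1) _ small]) (use U_splits U_chain' \<open>U \<noteq> {}\<close> in blast)+
    then obtain w1 where w1: "splits F S w1" "\<forall>p\<in>U. fst p \<subseteq>\<^sub>m w1" "ran w1 = (\<Union>p\<in>U. ran (fst p))" by auto
    have "\<exists>w. splits F T w \<and> (\<forall>u\<in>snd ` U. u \<subseteq>\<^sub>m w) \<and> ran w = (\<Union>u\<in>snd ` U. ran u)"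
      by (intro chain_union[OF T(1) _ small]) (use U_splits U_chain' \<open>U \<noteq> {}\<close> in blast)+
    then obtain w2 where w2: "splits F T w2" "\<forall>p\<in>U. snd p \<subseteq>\<^sub>m w2" "ran w2 = (\<Union>p\<in>U. ran (snd p))" by auto
    have node_w: "node w1" "node w2"
      using MI_node[OF S(1) splits_in[OF w1(1)]] MI_node[OF T(1) splits_in[OF w2(1)]] by auto
    have le_w: "le p (w1, w2)" if "p \<in> U" for p using that w1(2) w2(2) unfolding le_def by auto
    have ext: "end_ext (ran (fst p)) (ran w1)" "end_ext (ran (snd p)) (ran w2)" if "p \<in> U" for p
      using node[OF U_good[OF that]] node_w le_w[OF that] unfolding le_def
      by (auto intro: node_end_ext)
    \<comment> \<open>A point decided by the unions has one value beyond it from each side. The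
      longer of the two pairs supplying these values contains both, so the point and its bit are
      already present there.\<close>
    have cd_w: "\<exists>p\<in>U. cd p j = Some b" if j: "cd (w1, w2) j = Some b" for j b
    proof -
      have "j \<in> dom (code (ran w1) (ran w2))" using j unfolding cd_def by auto
      then obtain \<eta> where \<eta>: "\<eta> \<in> dclp (ran w1) (ran w2)" "j = rk (dclp (ran w1) (ran w2)) \<eta>"
        unfolding dom_code by blast
      then obtain x y where xy: "\<eta> \<in> clp (ran w1) (ran w2)" "x \<in> ran w1" "\<eta> \<le> x" "y \<in> ran w2" "\<eta> \<le> y"
        unfolding dclp_def by blast
      then obtain p q where pq: "p \<in> U" "x \<in> ran (fst p)" "q \<in> U" "y \<in> ran (snd q)"
        using w1(3) w2(3) by blast
      obtain r where r: "r \<in> U" "x \<in> ran (fst r)" "y \<in> ran (snd r)"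
      proof (cases "le p q")
        case True
        then have "x \<in> ran (fst q)" using pq(2) ran_mono[of "fst p" "fst q"] unfolding le_def by blast
        with pq that show thesis by blast
      next
        case False
        then have "y \<in> ran (snd p)"
          using U_chain[OF pq(1,3)] pq(4) ran_mono[of "snd q" "snd p"] unfolding le_def by blast
        with pq that show thesis by blast
      qed
      have "\<eta> \<in> clp (ran (fst r)) (ran (snd r))"
        using clp_end_ext[OF ext[OF r(1)] r(2) xy(3) r(3) xy(5)] xy(1) by simp
      then have \<eta>_r: "\<eta> \<in> dclp (ran (fst r)) (ran (snd r))"
        using r(2,3) xy(3,5) unfolding dclp_def by blast
      have "cd r j = cd (w1, w2) j"
        using code_rk[OF \<eta>_r] code_rk[OF \<eta>(1)] \<eta>(2) rk_end_ext[OF ext[OF r(1)] \<eta>_r]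
          leads_end_ext[OF ext[OF r(1)] \<eta>_r] unfolding cd_def by simp
      then show ?thesis using r(1) j by auto
    qed
    have il_w: "interleaved (ran w1) (ran w2)"
    proof -
      have il: "interleaved (ran (fst p)) (ran (snd p))" if "p \<in> U" for p
        using U_good[OF that] unfolding good_def by simp
      show ?thesis unfolding interleaved_def
      proof (intro conjI ballI)
        have st: "(s, t) \<in> U" unfolding U_def by simp
        then have "ran s \<subseteq> ran w1" using w1(3) by force
        then show "ran w1 \<noteq> {}" using il[OF st] unfolding interleaved_def by auto
        show "\<exists>y\<in>ran w2. x < y" if x: "x \<in> ran w1" for x
        proof -
          obtain p where p: "p \<in> U" "x \<in> ran (fst p)" using x w1(3) by blast
          then obtain y where "y \<in> ran (snd p)" "x < y" using il[OF p(1)] unfolding interleaved_def by blast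
          with p(1) show ?thesis unfolding w2(3) by blast
        qed
        show "\<exists>x\<in>ran w1. y < x" if y: "y \<in> ran w2" for y
        proof -
          obtain p where p: "p \<in> U" "y \<in> ran (snd p)" using y w2(3) by blast
          then obtain x where "x \<in> ran (fst p)" "y < x" using il[OF p(1)] unfolding interleaved_def by blast
          with p(1) show ?thesis unfolding w1(3) by blast
        qed
      qed
    qed
    have good_w: "good (w1, w2)"
      unfolding good_def
    proof (intro conjI allI impI)
      fix j b assume "cd (w1, w2) j = Some b"
      then obtain p where "p \<in> U" "cd p j = Some b" using cd_w by blast
      then show "b = g j" using U_good[of p] unfolding good_def by blast
    qed (use w1(1) w2(1) il_w le_w in \<open>auto simp: U_def\<close>)
    \<comment> \<open>Earlier stages supply every bit below \<open>i\<close>; thus if bit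
      \<open>i\<close> is absent, it is the next one to append.\<close>
    have dom_w: "{..<i} \<subseteq> dom (cd (w1, w2))"
    proof
      fix j assume "j \<in> {..<i}"
      then have "f j \<in> U" "j < i" unfolding U_def by auto
      then show "j \<in> dom (cd (w1, w2))"
        using map_le_implies_dom_le[OF cd_mono[OF U_good good_w le_w]] f(3) by blast
    qed
    show "\<exists>p. P f i p"
    proof (cases "i \<in> dom (cd (w1, w2))")
      case True
      then have "P f i (w1, w2)" unfolding P_def using good_w le_w unfolding U_def by auto
      then show ?thesis by blast
    next
      case False
      obtain s' t' where st: "splits F S s'" "splits F T t'" "w1 \<subseteq>\<^sub>m s'" "w2 \<subseteq>\<^sub>m t'"
          "interleaved (ran s') (ran t')" "code (ran s') (ran t') = (code (ran w1) (ran w2))(i \<mapsto> g i)"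
        using append_bit[OF S(1) w1(1) T(1) w2(1) il_w, of i "g i"] False dom_w unfolding cd_def by auto
      have le: "le (w1, w2) (s', t')" unfolding le_def using st by simp
      have cd: "cd (s', t') = (cd (w1, w2))(i \<mapsto> g i)" using st(6) unfolding cd_def by simp
      have "good (s', t')"
        unfolding good_def using st(1,2,5) good_w le_trans[OF _ le] unfolding cd good_def by auto
      moreover have "le (f j) (s', t')" if "j < i" for j
        using le_trans[OF le_w le] that unfolding U_def by blast
      ultimately have "P f i (s', t')" unfolding P_def using cd by simp
      then show ?thesis by blast
    qed
  qed (auto simp: P_def)
  then obtain f where "P f \<delta> (f \<delta>)" by blast
  then have \<delta>: "good (f \<delta>)" "\<delta> \<in> dom (cd (f \<delta>))" unfolding P_def by auto
  show thesis
  proof (rule that)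
    show "splits F S (fst (f \<delta>))" "splits F T (snd (f \<delta>))" "s \<subseteq>\<^sub>m fst (f \<delta>)" "t \<subseteq>\<^sub>m snd (f \<delta>)"
      using \<delta>(1) unfolding good_def le_def by auto
    fix j assume "j < \<delta>"
    \<comment> \<open>Stage \<delta> carries bit \<delta>, and code domains are initial segments, so
      all smaller indices are present.\<close>
    then obtain b where b: "cd (f \<delta>) j = Some b" using code_initial \<delta>(2) unfolding cd_def by blast
    then have "b = g j" using \<delta>(1) unfolding good_def by blast
    with b show "code (ran (fst (f \<delta>))) (ran (snd (f \<delta>))) j = Some (g j)" unfolding cd_def by simp
  qed
qed

section \<open>Cones are conditions\<close>

lemma not_eventually_single: "\<not> (\<forall>\<^sub>F \<beta> in F. \<beta> \<in> {x})"
proof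
  assume "\<forall>\<^sub>F \<beta> in F. \<beta> \<in> {x}"
  then have "\<forall>\<^sub>F \<beta> in F. False" using cobounded[of x] by eventually_elim simp
  then show False using proper by simp
qed

lemma succs_cone_above:
  assumes "T \<in> MI F" "u \<in> T" "u \<subseteq>\<^sub>m v" "node v"
  shows "succs (cone T u) v = succs T v"
  using map_le_trans[OF assms(3) snoc_map_le[OF assms(4)]] unfolding succs_def cone_def by auto

text \<open>A node properly below \<open>u\<close> can stay comparable with \<open>u\<close> in only
  one way, by following \<open>u\<close> itself.\<close>

lemma succs_cone_below:
  assumes T: "T \<in> MI F" and u: "u \<in> T" and v: "node v" "v \<subseteq>\<^sub>m u" "\<not> u \<subseteq>\<^sub>m v"
  shows "succs (cone T u) v = {the (u (lh v))}"
proof -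
  have node: "node u" using MI_node[OF T u] .
  have "lh v < lh u" using map_le_lh[OF node v(1)] v(2,3) by (meson not_less)
  then have "lh v \<in> dom u" using dom_node[OF node] by simp
  \<comment> \<open>\<beta> is the successor of \<open>lh v\<close>, so restricting \<open>u\<close>
    to it keeps exactly one value more than \<open>v\<close> has.\<close>
  obtain \<beta> where \<beta>: "{..<\<beta>} = {..lh v}" by (rule successor)
  have snoc: "u |` {..<\<beta>} = snoc v (the (u (lh v)))"
  proof
    fix x
    have "u x = v x" if "x < lh v"
      using that v(2) dom_node[OF v(1)] unfolding map_le_def by auto
    moreover have "v x = None" if "\<not> x < lh v" using that dom_node[OF v(1)] by auto
    ultimately show "(u |` {..<\<beta>}) x = snoc v (the (u (lh v))) x"
      using \<open>lh v \<in> dom u\<close> unfolding \<beta> snoc_def restrict_map_def by (auto simp: le_less)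
  qed
  have "snoc v (the (u (lh v))) \<in> T" using MI_restrict[OF T u] snoc by metis
  moreover have "u |` {..<\<beta>} \<subseteq>\<^sub>m u" by (auto simp: map_le_def)
  ultimately have "the (u (lh v)) \<in> succs (cone T u) v" unfolding succs_def cone_def by (simp add: snoc)
  moreover have "\<gamma> = the (u (lh v))" if \<gamma>: "\<gamma> \<in> succs (cone T u) v" for \<gamma>
  proof -
    have "snoc v \<gamma> (lh v) = Some \<gamma>" unfolding snoc_def by simp
    moreover have "snoc v \<gamma> (lh v) = u (lh v)"
      using \<gamma> \<open>lh v \<in> dom u\<close> calculation unfolding succs_def cone_def map_le_def
      by (metis (mono_tags, lifting) domI mem_Collect_eq)
    ultimately show ?thesis by (metis option.sel)
  qed
  ultimately show ?thesis by blast
qed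

text \<open>From \<open>u\<close> on, the cone has the same successors as the tree; properly below
  \<open>u\<close> it has a single one, and no singleton lies in the filter.\<close>

lemma splits_cone:
  assumes T: "T \<in> MI F" and u: "u \<in> T"
  shows "splits F (cone T u) v \<longleftrightarrow> u \<subseteq>\<^sub>m v \<and> splits F T v"
proof (cases "v \<in> T")
  case True
  then have "node v" using MI_node[OF T] by blast
  then show ?thesis
    using succs_cone_above[OF T u, of v] succs_cone_below[OF T u, of v] not_eventually_single True
    unfolding splits_def by (cases "u \<subseteq>\<^sub>m v") (auto simp: cone_def[of T u])
qed (auto simp: splits_def cone_def)

lemma cone_MI:
  assumes T: "T \<in> MI F" and u: "u \<in> T"
  shows "cone T u \<in> MI F"
proof -
  have node_u: "node u" using MI_node[OF T u] .
  have sub: "cone T u \<subseteq> T" unfolding cone_def by blast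
  have T': "is_tree T" "\<forall>u\<in>T. strict_mono_on (dom u) (\<lambda>\<xi>. the (u \<xi>))"
    "\<forall>u\<in>T. \<not> splits F T u \<longrightarrow> card (succs T u) = 1"
    "\<forall>\<alpha> u. limit_ordinal \<alpha> \<and> u \<in> seqs \<alpha> \<and> (\<forall>\<beta><\<alpha>. u |` {..<\<beta>} \<in> T) \<longrightarrow> u \<in> T"
    using T unfolding MI_def by blast+
  have "is_tree (cone T u)"
    unfolding is_tree_def
  proof (intro conjI ballI allI)
    show "cone T u \<noteq> {}" using u unfolding cone_def by auto
    show "cone T u \<subseteq> (\<Union>\<alpha>. seqs \<alpha>)" using sub T'(1) unfolding is_tree_def by blast
    fix v \<beta> assume v: "v \<in> cone T u"
    then have "v |` {..<\<beta>} \<in> T" using MI_restrict[OF T] sub by blast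
    moreover have "v |` {..<\<beta>} \<subseteq>\<^sub>m v" by (auto simp: map_le_def)
    ultimately show "v |` {..<\<beta>} \<in> cone T u"
      using v node_comparable[OF MI_node[OF T] node_u, of "v |` {..<\<beta>}" v] map_le_trans
      unfolding cone_def by blast
  qed
  moreover have "\<forall>v\<in>cone T u. strict_mono_on (dom v) (\<lambda>\<xi>. the (v \<xi>))" using T'(2) sub by blast
  moreover have "(\<exists>w\<in>cone T u. v \<subseteq>\<^sub>m w \<and> splits F (cone T u) w)
      \<and> (\<not> splits F (cone T u) v \<longrightarrow> card (succs (cone T u) v) = 1)" if v: "v \<in> cone T u" for v
  proof
    have "v \<in> T" "node v" using v sub MI_node[OF T] by auto
    \<comment> \<open>Take a splitting node above the longer of the comparable nodes
      \<open>u\<close> and \<open>v\<close>.\<close>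
    have "\<exists>w. splits F T w \<and> u \<subseteq>\<^sub>m w \<and> v \<subseteq>\<^sub>m w"
      using v MI_splits[OF T u] MI_splits[OF T \<open>v \<in> T\<close>] map_le_trans unfolding cone_def by blast
    then show "\<exists>w\<in>cone T u. v \<subseteq>\<^sub>m w \<and> splits F (cone T u) w"
      using splits_cone[OF T u] splits_in by blast
    show "\<not> splits F (cone T u) v \<longrightarrow> card (succs (cone T u) v) = 1"
      using v T'(3) splits_cone[OF T u, of v] succs_cone_above[OF T u _ \<open>node v\<close>]
        succs_cone_below[OF T u \<open>node v\<close>] unfolding cone_def by (cases "u \<subseteq>\<^sub>m v") auto
  qed
  moreover have "v \<in> cone T u"
    if v: "limit_ordinal \<alpha>" "v \<in> seqs \<alpha>" "\<forall>\<beta><\<alpha>. v |` {..<\<beta>} \<in> cone T u" for \<alpha> v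
  proof -
    have "v \<in> T" using T'(4) v sub by blast
    moreover have "v \<subseteq>\<^sub>m u \<or> u \<subseteq>\<^sub>m v"
    proof (cases "\<exists>\<beta><\<alpha>. u \<subseteq>\<^sub>m v |` {..<\<beta>}")
      case True
      then obtain \<beta> where "u \<subseteq>\<^sub>m v |` {..<\<beta>}" by blast
      moreover have "v |` {..<\<beta>} \<subseteq>\<^sub>m v" by (auto simp: map_le_def)
      ultimately show ?thesis using map_le_trans by blast
    next
      case False
      \<comment> \<open>No proper restriction of \<open>v\<close> extends \<open>u\<close>, so each
        lies below \<open>u\<close>; since the length of \<open>v\<close> is a limit, these
        restrictions cover \<open>v\<close>.\<close>
      have "v x = u x" if "x \<in> dom v" for x
      proof -
        have "x < \<alpha>" using that v(2) unfolding seqs_def by auto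
        then obtain \<beta> where \<beta>: "x < \<beta>" "\<beta> < \<alpha>" using v(1) unfolding limit_ordinal_def by blast
        have "v |` {..<\<beta>} \<subseteq>\<^sub>m u" using \<beta>(2) False v(3) unfolding cone_def by blast
        moreover have "x \<in> dom (v |` {..<\<beta>})" using \<beta>(1) that by auto
        ultimately have "(v |` {..<\<beta>}) x = u x" unfolding map_le_def by blast
        then show ?thesis using \<beta>(1) by simp
      qed
      then show ?thesis unfolding map_le_def by blast
    qed
    ultimately show ?thesis unfolding cone_def by blast
  qed
  moreover have "splits F (cone T u) v"
    if v: "limit_ordinal \<alpha>" "v \<in> seqs \<alpha>"
      "\<forall>\<gamma><\<alpha>. \<exists>\<beta>. \<gamma> \<le> \<beta> \<and> \<beta> < \<alpha> \<and> splits F (cone T u) (v |` {..<\<beta>})" for \<alpha> v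
  proof -
    have "splits F T v"
      by (rule MI_limit_splits[OF T v(1)]) (use v(2,3) splits_cone[OF T u] in \<open>auto simp: seqs_def\<close>)
    moreover obtain \<beta> where "u \<subseteq>\<^sub>m v |` {..<\<beta>}"
      using v(1,3) splits_cone[OF T u] unfolding limit_ordinal_def by blast
    moreover have "v |` {..<\<beta>} \<subseteq>\<^sub>m v" for \<beta> by (auto simp: map_le_def)
    ultimately show ?thesis using splits_cone[OF T u] map_le_trans by blast
  qed
  ultimately show ?thesis unfolding MI_def by blast
qed

section \<open>Verifying the criterion for the product\<close>

lemma adds_Cohen_function:
  "forcing.adds_Cohen_function (MI F \<times> MI F) (prod_le (\<subseteq>) (\<subseteq>)) (UNIV :: 'k set)"
proof -
  \<comment> \<open>A bit counts as settled when every pair of splitting nodes shows it. Shrinking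
    the trees leaves fewer splitting nodes, which gives monotonicity; their existence gives
    uniqueness of the bit.\<close>
  define C where "C = (\<lambda>(S, T) i b. \<forall>s t. splits F S s \<and> splits F T t \<longrightarrow> code (ran s) (ran t) i = Some b)"
  show ?thesis
  proof (rule forcing.adds_Cohen_functionI[where C = C])
    show "infinite (UNIV :: 'k set)" by (rule infinite_kappa)
    show "prod_le (\<subseteq>) (\<subseteq>) p p" for p :: "('k \<rightharpoonup> 'k) set \<times> ('k \<rightharpoonup> 'k) set"
      by (cases p) (simp add: prod_le_def)
    show "prod_le (\<subseteq>) (\<subseteq>) p r" if "prod_le (\<subseteq>) (\<subseteq>) p q" "prod_le (\<subseteq>) (\<subseteq>) q r"
      for p q r :: "('k \<rightharpoonup> 'k) set \<times> ('k \<rightharpoonup> 'k) set"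
      using that by (cases p; cases q; cases r) (auto simp: prod_le_def)
    show "C p i b" if "prod_le (\<subseteq>) (\<subseteq>) p q" "C q i b" for p q i b
      using that splits_mono[of "fst p" "fst q" F] splits_mono[of "snd p" "snd q" F]
      by (cases p; cases q) (auto simp: prod_le_def C_def)
    show "b = b'" if p: "p \<in> MI F \<times> MI F" and "C p i b" "C p i b'" for p i b b'
    proof -
      obtain S T where [simp]: "p = (S, T)" by (cases p)
      have "S \<in> MI F" "T \<in> MI F" using p by auto
      then obtain s t where "splits F S s" "splits F T t" using MI_splits_ex by meson
      then show ?thesis using that(2,3) unfolding C_def by auto
    qed
    fix p assume "p \<in> MI F \<times> MI F"
    then obtain S T where p: "p = (S, T)" and S: "S \<in> MI F" and T: "T \<in> MI F" by blast
    obtain s0 t0 where "splits F S s0" "splits F T t0"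
      using MI_splits_ex[OF S] MI_splits_ex[OF T] by blast
    then obtain s t where st: "splits F S s" "splits F T t" "interleaved (ran s) (ran t)"
      using alternate[OF S _ T] by metis
    have node: "node s" "node t"
      using MI_node[OF S splits_in[OF st(1)]] MI_node[OF T splits_in[OF st(2)]] by auto
    \<comment> \<open>Ranks never exceed the points they number, and decided points lie below a
      bound for \<open>ran s\<close>.\<close>
    have "code (ran s) (ran t) \<in> Fn UNIV"
    proof -
      obtain \<gamma> where \<gamma>: "\<forall>x\<in>ran s. x < \<gamma>" using node_ran_bounded[OF node(1)] by blast
      have "rk (dclp (ran s) (ran t)) \<eta> < \<gamma>" if "\<eta> \<in> dclp (ran s) (ran t)" for \<eta>
      proof -
        obtain x where x: "x \<in> ran s" "\<eta> \<le> x" using \<open>\<eta> \<in> dclp (ran s) (ran t)\<close> unfolding dclp_def by blast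
        have "rk (dclp (ran s) (ran t)) \<eta> \<le> x" using rk_le x(2) by (rule order_trans)
        with \<gamma> x(1) show ?thesis by (blast intro: le_less_trans)
      qed
      then have "dom (code (ran s) (ran t)) \<subseteq> {..<\<gamma>}" unfolding dom_code by blast
      then show ?thesis unfolding Fn_def using small_subset[OF _ small_segment] by auto
    qed
    moreover have "\<exists>r\<in>MI F \<times> MI F. prod_le (\<subseteq>) (\<subseteq>) r p \<and> (\<forall>i b. \<sigma> i = Some b \<longrightarrow> C r i b)"
      if \<sigma>: "\<sigma> \<in> Fn UNIV" "code (ran s) (ran t) \<subseteq>\<^sub>m \<sigma>" for \<sigma>
    proof -
      have "|dom \<sigma>| <o |UNIV :: 'k set|" using \<sigma>(1) unfolding Fn_def by simp
      then obtain \<delta> where \<delta>: "\<forall>i\<in>dom \<sigma>. i < \<delta>" by (rule small_bounded)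
      have agree: "b = the (\<sigma> j)" if "code (ran s) (ran t) j = Some b" for j b
        using that \<sigma>(2) unfolding map_le_def by force
      \<comment> \<open>A whole initial segment covering \<open>dom \<sigma>\<close> is written;
        outside \<open>dom \<sigma>\<close> the values \<open>the (\<sigma> j)\<close> are arbitrary
        fillers.\<close>
      obtain s' t' where st': "splits F S s'" "splits F T t'"
          "\<And>j. j < \<delta> \<Longrightarrow> code (ran s') (ran t') j = Some (the (\<sigma> j))"
      proof (rule write_bits[OF S st(1) T st(2,3), where g = "\<lambda>j. the (\<sigma> j)" and \<delta> = \<delta>])
        show "b = the (\<sigma> j)" if "code (ran s) (ran t) j = Some b" for j b using that by (rule agree)
      qed (rule that)
      have "s' \<in> S" "t' \<in> T" using st' splits_in by blast+
      have "C (cone S s', cone T t') i b" if i: "\<sigma> i = Some b" for i b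
        unfolding C_def prod.case
      proof (intro allI impI)
        fix u v assume "splits F (cone S s') u \<and> splits F (cone T t') v"
        then have uv: "s' \<subseteq>\<^sub>m u" "splits F S u" "t' \<subseteq>\<^sub>m v" "splits F T v"
          using splits_cone[OF S \<open>s' \<in> S\<close>] splits_cone[OF T \<open>t' \<in> T\<close>] by auto
        \<comment> \<open>Splitting nodes of the cones extend \<open>s'\<close> and
          \<open>t'\<close>, so their codes keep every bit just written.\<close>
        have "code (ran s') (ran t') \<subseteq>\<^sub>m code (ran u) (ran v)"
          using uv MI_node[OF S splits_in] MI_node[OF T splits_in] st'(1,2)
          by (intro code_mono node_end_ext) auto
        moreover have "code (ran s') (ran t') i = Some b" using st'(3)[of i] \<delta> i by auto
        ultimately show "code (ran u) (ran v) i = Some b" unfolding map_le_def by force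
      qed
      moreover have "(cone S s', cone T t') \<in> MI F \<times> MI F"
        using cone_MI S T \<open>s' \<in> S\<close> \<open>t' \<in> T\<close> by blast
      moreover have "prod_le (\<subseteq>) (\<subseteq>) (cone S s', cone T t') p"
        unfolding p prod_le_def cone_def by auto
      ultimately show ?thesis by blast
    qed
    ultimately show "\<exists>c\<in>Fn UNIV. \<forall>\<sigma>\<in>Fn UNIV. c \<subseteq>\<^sub>m \<sigma> \<longrightarrow>
        (\<exists>r\<in>MI F \<times> MI F. prod_le (\<subseteq>) (\<subseteq>) r p \<and> (\<forall>i b. \<sigma> i = Some b \<longrightarrow> C r i b))"
      by blast
  qed
qed

end

theorem theorem5p25:
  fixes F :: "'k::wellorder filter"
  assumes "strongly_inaccessible {(\<alpha>, \<beta>). \<alpha> \<le> (\<beta> :: 'k)}"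
    and "F \<noteq> bot"
    and "kappa_complete F"
    and "normal_filter F"
    and "nonprincipal F"
  shows "forcing.adds_Cohen_function (MI F \<times> MI F) (prod_le (\<subseteq>) (\<subseteq>)) (UNIV :: 'k set)"
proof (cases "MI F = {}")
  \<comment> \<open>Without conditions every sentence is forced vacuously.\<close>
  case True
  then show ?thesis
    unfolding forcing.adds_Cohen_function_def forcing.forced_def by auto
next
  case False
  interpret kappa_filter F by unfold_locales fact+
  interpret cobounded_filter F
    by unfold_locales (use MI_nonempty_cobounded[OF assms(5)] False in blast)
  show ?thesis by (rule adds_Cohen_function)
qed

end
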